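(* For $r\in\mathbb{Z}$ let $$\Phi^{r}(x,y):=1+\sum_{n\geq1}\sum_{\sigma\in S_{n}}\frac{y^{n}}{n!}\det(I_{n}-xM_{\sigma})^{r}.$$ Then, for every $r\in\mathbb{Z}$, $$\mathrm{Res}_{y=1}\Phi^{r}(x,y)=-\prod_{k\geq1}(1-x^{k})^{-\binom{k-r-1}{k}}.$$ In particular, when $c=-r>0$, $-\mathrm{Res}_{y=1}\Phi^{-c}(x,y)$ is the generating function $\sum_{n\ge 0}p_c(n)x^n$, where $p_c(n)$ is the number of colored partitions of $n$ with $c$ colors (with $p_c(0)=1$).
   Context: $S_n$ is the symmetric group on $n$ letters, $M_\sigma$ the $n\times n$ permutation matrix of $\sigma\in S_n$, $I_n$ the $n\times n$ identity matrix. The polynomial $\det(I_n-xM_\sigma)$ has constant term $1$, so its integer powers are formal power series in $x$. Binomial numbers: $\binom{a}{k}=\frac{a(a-1)\cdots(a-k+1)}{k!}$ for integers $a$ and $k\ge0$, $\binom{a}{0}=1$. Residue: $\Phi^r(x,y)$ has a factor $1/(1-y)$, corresponding to a pole of order $1$ at $y=1$. The residue at $y=1$ is taken coefficientwise in $x$: for each $m\ge 0$ the coefficient of $x^m$ in $\Phi^r(x,y)$ is a rational function of $y$ with at most a simple pole at $y=1$, and $\mathrm{Res}_{y=1}\Phi^r(x,y)$ is the formal power series in $x$ whose $x^m$-coefficient is the residue at $y=1$ of that rational function (so if $\Phi^r(x,y)=(1-y)^{-1}A(x,y)$ with $A$ a power series in $x$ with coefficients polynomial in $y$, the residue is $-A(x,1)$).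 Colored partitions: a colored partition of $n\in\mathbb{N}$ with $c$ colors is obtained by taking a partition $n=n_1+\cdots+n_m$, $n_1\ge\cdots\ge n_m\ge1$, regarding each part $n_j$ as a collection of $n_j$ identical objects, and coloring each object with one of $c$ colors, disregarding the order of the colored objects. That is, it is a finite multiset of nonempty multisets of colors (the parts), with total number of objects $n$. For example, for $c=3$ with colors $b,w,r$ the colored partitions of $2$ are the 12 elements $bb,bw,br,ww,wr,rr,b+b,b+w,b+r,w+w,w+r,r+r$. *)

theory Defs
  imports
    "HOL-Complex_Analysis.Complex_Analysis"
    "HOL-Computational_Algebra.Computational_Algebra"
    "HOL-Combinatorics.Permutations"
    "Jordan_Normal_Form.Determinant"
begin

text \<open>The division is exact. The library's \<open>gchoose\<close> is constrained to fields in this context.\<close>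

definition int_binomial :: "int \<Rightarrow> nat \<Rightarrow> int" where
  "int_binomial a k = (\<Prod>i = 0..<k. a - int i) div fact k"

lemma of_int_int_binomial: "of_int (int_binomial a k) = (of_int a gchoose k :: 'a :: field_char_0)"
  using of_int_gbinomial[of a k, where ?'a = 'a] unfolding int_binomial_def
  by (simp only: gbinomial_prod_rev)

definition permutation_matrix :: "nat \<Rightarrow> (nat \<Rightarrow> nat) \<Rightarrow> 'a :: zero_neq_one mat" where
  "permutation_matrix n \<sigma> = Matrix.mat n n (\<lambda>(i, j). if i = \<sigma> j then 1 else 0)"

definition det_one_minus_x_perm :: "nat \<Rightarrow> (nat \<Rightarrow> nat) \<Rightarrow> complex poly" where
  "det_one_minus_x_perm n \<sigma> =
     Determinant.det (1\<^sub>m n - [:0, 1:] \<cdot>\<^sub>m permutation_matrix n \<sigma>)"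

text \<open>The two-variable series is represented as a power series in \<open>y\<close> (outer variable) whose
  coefficients are power series in \<open>x\<close> (inner variable). The integer power \<open>powi\<close> is the one in
  the ring of power series, where \<^term>\<open>fps_of_poly (det_one_minus_x_perm n \<sigma>)\<close> is a unit.\<close>

definition Phi :: "int \<Rightarrow> complex fps fps" where
  "Phi r = 1 + Abs_fps (\<lambda>n. if n = 0 then 0 else
     (\<Sum>\<sigma> | \<sigma> permutes {..<n}.
        fps_const (1 / fact n) * fps_of_poly (det_one_minus_x_perm n \<sigma>) powi r))"

text \<open>The coefficient of \<open>x ^ m\<close>, as a power series in \<open>y\<close>.\<close>

definition x_coeff :: "nat \<Rightarrow> complex fps fps \<Rightarrow> complex fps" where
  "x_coeff m F = Abs_fps (\<lambda>n. fps_nth (fps_nth F n) m)"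

text \<open>\<open>f\<close> is the expansion at \<open>0\<close> of the rational function \<open>p / q\<close> in lowest terms; \<open>p\<close> and \<open>q\<close> are
  then unique up to a common nonzero constant factor, and \<open>order a q\<close> is the order of the pole
  of the rational function at \<open>a\<close> (0 if there is none).\<close>

definition is_expansion_of :: "complex fps \<Rightarrow> complex poly \<Rightarrow> complex poly \<Rightarrow> bool" where
  "is_expansion_of f p q \<longleftrightarrow> q \<noteq> 0 \<and> coprime p q \<and> f * fps_of_poly q = fps_of_poly p"

definition rational_at_most_simple_pole :: "complex fps \<Rightarrow> complex \<Rightarrow> bool" where
  "rational_at_most_simple_pole f a \<longleftrightarrow> (\<exists>p q. is_expansion_of f p q \<and> order a q \<le> 1)"

text \<open>The residue at \<open>a\<close> of the rational function whose expansion at \<open>0\<close> is \<open>f\<close>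
  (unspecified if \<open>f\<close> is not rational).\<close>

definition rational_residue :: "complex fps \<Rightarrow> complex \<Rightarrow> complex" where
  "rational_residue f a =
     (case SOME (p, q). is_expansion_of f p q of (p, q) \<Rightarrow> residue (\<lambda>y. poly p y / poly q y) a)"

definition Res_y :: "complex \<Rightarrow> complex fps fps \<Rightarrow> complex fps" where
  "Res_y a F = Abs_fps (\<lambda>m. rational_residue (x_coeff m F) a)"

text \<open>Colored partitions of \<open>n\<close> with colors \<open>0, \<dots>, c - 1\<close>: multisets of nonempty multisets of
  colors (the parts) with \<open>n\<close> objects in total.\<close>

definition colored_partitions :: "nat \<Rightarrow> nat \<Rightarrow> nat multiset multiset set" where
  "colored_partitions c n =
     {P. (\<forall>M \<in># P. M \<noteq> {#} \<and> set_mset M \<subseteq> {..<c}) \<and> (\<Sum>M \<in># P. size M) = n}"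

end

theory Submission
  imports Defs "HOL-Combinatorics.Cycles"
begin

text \<open>The cycle through a chosen point of \<open>{..<n}\<close> contributes the factor \<open>1 - x\<^sup>k\<close> to
  \<open>det (I - x M)\<close>, where \<open>k\<close> is the length of the cycle. Hence the coefficients \<open>a\<^sub>n\<close> of \<open>y ^ n\<close> in \<open>\<Phi>\<^sup>r\<close> satisfy
  \<open>n a\<^sub>n = (\<Sum>k=1..n. (1 - x\<^sup>k)\<^sup>r a\<^bsub>n-k\<^esub>)\<close>. Let \<open>e\<^sub>j\<close> be the coefficient of \<open>x\<^sup>j\<close> in \<open>(1 - x)\<^sup>r\<close>. By the logarithmic
  derivative in \<open>y\<close>, the product of the factors \<open>1 - x\<^sup>j y\<close> to the powers \<open>-e\<^sub>j\<close>, for \<open>j \<ge> 0\<close>,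
  satisfies the same recurrence and is therefore \<open>\<Phi>\<^sup>r\<close>. Its factor for \<open>j = 0\<close> is \<open>1 / (1 - y)\<close>; in the
  remaining factors the power of \<open>y\<close> never exceeds that of \<open>x\<close>, so that one can put \<open>y = 1\<close>. All
  identities are used modulo a power of \<open>x\<close>, where finitely many factors suffice. For
  \<open>r = - c\<close> the number \<open>e\<^sub>j\<close> counts the multisets of \<open>j\<close> colors, that is the possible parts of size \<open>j\<close>.\<close>

section \<open>Cycles and the determinant\<close>

text \<open>Extending by the identity makes this a permutation of every set containing
  \<open>S\<close>, so that its \<open>sign\<close> makes sense.\<close>

definition restrict_perm :: "('a \<Rightarrow> 'a) \<Rightarrow> 'a set \<Rightarrow> 'a \<Rightarrow> 'a" where
  "restrict_perm \<sigma> S = (\<lambda>x. if x \<in> S then \<sigma> x else x)"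

lemma restrict_perm_permutes:
  assumes "\<sigma> permutes A" "\<sigma> ` S = S"
  shows "restrict_perm \<sigma> S permutes S"
proof (rule bij_imp_permutes)
  have "inj_on \<sigma> S" using permutes_inj[OF assms(1)] by (rule inj_on_subset) simp
  then show "bij_betw (restrict_perm \<sigma> S) S S"
    using assms(2) by (auto simp: bij_betw_def restrict_perm_def inj_on_def)
qed (simp add: restrict_perm_def)

text \<open>If the restriction permutes \<open>A\<close>, it is bijective and fixes the complement
  of \<open>S\<close> pointwise, so it must also map \<open>S\<close> onto \<open>S\<close>.\<close>

lemma restrict_perm_permutes_iff:
  assumes "\<sigma> permutes A" "S \<subseteq> A"
  shows "restrict_perm \<sigma> S permutes A \<longleftrightarrow> \<sigma> ` S = S"
proof
  assume "\<sigma> ` S = S"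
  then show "restrict_perm \<sigma> S permutes A"
    using restrict_perm_permutes[OF assms(1)] assms(2) permutes_subset by blast
next
  assume p: "restrict_perm \<sigma> S permutes A"
  have bij: "bij (restrict_perm \<sigma> S)" using permutes_bij[OF p] .
  have 1: "restrict_perm \<sigma> S ` (-S) = -S" by (force simp: restrict_perm_def)
  have "restrict_perm \<sigma> S ` S = S"
    using bij_image_Compl_eq[OF bij, of "-S"] 1 by simp
  then show "\<sigma> ` S = S" by (simp add: restrict_perm_def image_def)
qed

text \<open>The Leibniz expansion of \<open>det (I - x M)\<close> for the permutation matrix \<open>M\<close> of \<open>\<sigma>\<close> on an arbitrary
  finite set: a term that takes \<open>-x\<close> from the columns in \<open>S\<close> survives only if \<open>S\<close> is invariant.\<close>

definition cycle_poly :: "'a set \<Rightarrow> ('a \<Rightarrow> 'a) \<Rightarrow> 'b \<Rightarrow> 'b :: comm_ring_1" where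
  "cycle_poly A \<sigma> x =
     (\<Sum>S | S \<subseteq> A \<and> \<sigma> ` S = S. of_int (sign (restrict_perm \<sigma> S)) * (- x) ^ card S)"

lemma det_one_minus_x_perm_eq_cycle_poly:
  assumes "\<sigma> permutes {..<n}"
  shows "det_one_minus_x_perm n \<sigma> = cycle_poly {..<n} \<sigma> [:0, 1:]"
proof -
  define x :: "complex poly" where "x = [:0, 1:]"
  let ?A = "{..<n}"
  let ?M = "1\<^sub>m n - x \<cdot>\<^sub>m permutation_matrix n \<sigma>"
  have M: "?M \<in> carrier_mat n n"
    by (simp add: permutation_matrix_def minus_carrier_mat)
  have entry: "(\<Prod>i<n. ?M $$ (p i, i)) =
      (\<Sum>S\<in>Pow ?A. if p = restrict_perm \<sigma> S then (- x) ^ card S else 0)"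
    if p: "p permutes ?A" for p
  proof -
    have pn: "p i < n" if "i < n" for i using permutes_in_image[OF p, of i] that by simp
    \<comment> \<open>The two indicators are added, not exclusive: a fixed point of
      \<open>\<sigma>\<close> has the diagonal entry \<open>1 - x\<close>. In the expansion,
      \<open>S\<close> collects the columns from which \<open>- x\<close> is chosen.\<close>
    have "(\<Prod>i<n. ?M $$ (p i, i)) =
        (\<Prod>i<n. (if p i = \<sigma> i then - x else 0) + (if p i = i then 1 else 0))"
      using pn by (intro prod.cong) (auto simp: permutation_matrix_def)
    also have "\<dots> = (\<Sum>S\<in>Pow ?A. (\<Prod>i\<in>S. if p i = \<sigma> i then - x else 0) *
                       (\<Prod>i\<in>?A - S. if p i = i then 1 else 0))"
      by (rule prod_add) simp
    also have "\<dots> = (\<Sum>S\<in>Pow ?A. if p = restrict_perm \<sigma> S then (- x) ^ card S else 0)"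
    proof (intro sum.cong refl)
      fix S assume S: "S \<in> Pow ?A"
      then have fin: "finite S" by (auto intro: finite_subset)
      show "(\<Prod>i\<in>S. if p i = \<sigma> i then - x else 0) * (\<Prod>i\<in>?A - S. if p i = i then 1 else 0)
          = (if p = restrict_perm \<sigma> S then (- x) ^ card S else 0)"
      proof (cases "p = restrict_perm \<sigma> S")
        case True
        then show ?thesis by (simp add: restrict_perm_def)
      next
        case False
        \<comment> \<open>Off \<open>?A\<close> both maps are the identity, so they differ inside
          \<open>?A\<close>, and the factor of that column vanishes.\<close>
        then obtain i where i: "p i \<noteq> restrict_perm \<sigma> S i" by auto
        with permutes_not_in[OF p, of i] S have "i \<in> ?A" 
          by (cases "i \<in> ?A") (auto simp: restrict_perm_def split: if_splits)
        with i fin have "(\<exists>i\<in>S. p i \<noteq> \<sigma> i) \<or> (\<exists>i\<in>?A - S. p i \<noteq> i)"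
          by (auto simp: restrict_perm_def split: if_splits)
        with False fin show ?thesis
          by (auto simp: prod_zero_iff)
      qed
    qed
    finally show ?thesis .
  qed
  have "det_one_minus_x_perm n \<sigma> = (\<Sum>p | p permutes ?A. signof p * (\<Prod>i<n. ?M $$ (p i, i)))"
    unfolding det_one_minus_x_perm_def x_def[symmetric] mat_det_left_def[OF M]
    by (simp add: permutation_matrix_def lessThan_atLeast0)
  also have "\<dots> = (\<Sum>p | p permutes ?A. \<Sum>S\<in>Pow ?A.
                    if p = restrict_perm \<sigma> S then signof p * (- x) ^ card S else 0)"
    by (intro sum.cong refl) (auto simp: entry sum_distrib_left intro!: sum.cong)
  also have "\<dots> = (\<Sum>S\<in>Pow ?A. \<Sum>p | p permutes ?A.
                    if p = restrict_perm \<sigma> S then signof p * (- x) ^ card S else 0)"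
    by (rule sum.swap)
  also have "\<dots> = (\<Sum>S\<in>Pow ?A. if \<sigma> ` S = S then signof (restrict_perm \<sigma> S) * (- x) ^ card S else 0)"
  proof (intro sum.cong refl)
    fix S assume S: "S \<in> Pow ?A"
    \<comment> \<open>For fixed \<open>S\<close> the only candidate is
      \<open>p = restrict_perm \<sigma> S\<close>; it occurs in the sum exactly when
      \<open>S\<close> is invariant.\<close>
    have "finite {p. p permutes ?A}" by (simp add: finite_permutations)
    then show "(\<Sum>p | p permutes ?A.
            if p = restrict_perm \<sigma> S then signof p * (- x) ^ card S else 0) =
       (if \<sigma> ` S = S then signof (restrict_perm \<sigma> S) * (- x) ^ card S else 0)"
      using restrict_perm_permutes_iff[OF assms, of S] S by (simp add: sum.delta')
  qed
  also have "\<dots> = cycle_poly ?A \<sigma> [:0, 1:]"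
    unfolding cycle_poly_def x_def by (rule sum.mono_neutral_cong_right) auto
  finally show ?thesis .
qed

section \<open>Signs, powers and invariant sets of a single cycle\<close>

lemma sign_cycle_of_list:
  assumes "distinct cs" "cs \<noteq> []"
  shows "sign (cycle_of_list cs) = (-1) ^ (length cs - 1)"
  using assms
proof (induction cs rule: cycle_of_list.induct)
  case (1 i j cs)
  \<comment> \<open>The recursion splits off one transposition per element, so a cycle of length k
    is a product of k - 1 transpositions.\<close>
  have "sign (cycle_of_list (i # j # cs)) = sign (Transposition.transpose i j) * sign (cycle_of_list (j # cs))"
    by (simp add: sign_compose permutation_swap_id permutation_of_cycle)
  with 1 show ?case by (simp add: sign_swap_id del: cycle_of_list.simps)
qed (simp_all add: sign_id)

lemma funpow_cycle_of_list_nth: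
  assumes "distinct cs" "i < length cs"
  shows "(cycle_of_list cs ^^ n) (cs ! i) = cs ! ((i + n) mod length cs)"
proof -
  have "(cycle_of_list cs ^^ n) (cs ! i) = map (cycle_of_list cs ^^ n) cs ! i"
    using assms(2) by simp
  also have "\<dots> = rotate n cs ! i" using cyclic_rotation[OF assms(1)] by metis
  also have "\<dots> = cs ! ((i + n) mod length cs)" using assms(2) by (simp add: nth_rotate add.commute)
  finally show ?thesis .
qed

text \<open>A cycle acts transitively on its elements, so the powers of the cycle carry one point of
  \<open>T\<close> to all of them.\<close>

lemma cycle_of_list_invariant_subset:
  assumes "distinct cs" "T \<subseteq> set cs" "cycle_of_list cs ` T = T"
  shows "T = {} \<or> T = set cs"
proof (cases "T = {}")
  case False
  then obtain i where i: "i < length cs" "cs ! i \<in> T"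
    using assms(2) by (metis all_not_in_conv in_set_conv_nth subsetD)
  have inv: "(cycle_of_list cs ^^ n) x \<in> T" if "x \<in> T" for n x
    using that assms(3) by (induction n) auto
  have "cs ! j \<in> T" if "j < length cs" for j
  proof -
    \<comment> \<open>Adding the length keeps the subtraction of \<open>i\<close> from truncating
      and changes nothing modulo the length.\<close>
    have "(cycle_of_list cs ^^ (j + length cs - i)) (cs ! i) = cs ! j"
      using i that by (simp add: funpow_cycle_of_list_nth[OF assms(1)])
    then show ?thesis using inv[OF i(2)] by metis
  qed
  then show ?thesis using assms(2) by (auto simp: in_set_conv_nth)
qed simp

lemma cycle_compose_apply:
  assumes "\<tau> permutes B" "set cs \<inter> B = {}"
  shows "x \<in> set cs \<Longrightarrow> (cycle_of_list cs \<circ> \<tau>) x = cycle_of_list cs x"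
    and "x \<notin> set cs \<Longrightarrow> (cycle_of_list cs \<circ> \<tau>) x = \<tau> x"
proof -
  show "(cycle_of_list cs \<circ> \<tau>) x = cycle_of_list cs x" if "x \<in> set cs"
    using that assms permutes_not_in by fastforce
  show "(cycle_of_list cs \<circ> \<tau>) x = \<tau> x" if "x \<notin> set cs"
  proof -
    have "\<tau> x \<notin> set cs"
      using that assms permutes_not_in[OF assms(1), of x] permutes_in_image[OF assms(1), of x]
      by (cases "x \<in> B") auto
    then show ?thesis by (simp add: id_outside_supp)
  qed
qed

text \<open>The invariant sets of the composite are the \<open>\<tau>\<close>-invariant subsets of
  \<open>B\<close>, each with or without the whole cycle. Adding a cycle of length k multiplies a
  term by its sign (-1)^(k-1) and by (-x)^k, in total by -x^k.\<close>

lemma cycle_poly_cycle_compose: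
  fixes x :: "'b :: comm_ring_1"
  assumes "distinct cs" "cs \<noteq> []" "\<tau> permutes B" "finite B" "set cs \<inter> B = {}"
  shows "cycle_poly (set cs \<union> B) (cycle_of_list cs \<circ> \<tau>) x = (1 - x ^ length cs) * cycle_poly B \<tau> x"
proof -
  define c where "c = cycle_of_list cs"
  define \<sigma> where "\<sigma> = c \<circ> \<tau>"
  let ?C = "set cs"
  define V where "V = {T. T \<subseteq> B \<and> \<tau> ` T = T}"
  have \<sigma>C: "\<sigma> y = c y" if "y \<in> ?C" for y
    using cycle_compose_apply(1)[OF assms(3,5) that] by (simp add: \<sigma>_def c_def)
  have \<sigma>B: "\<sigma> y = \<tau> y" if "y \<notin> ?C" for y
    using cycle_compose_apply(2)[OF assms(3,5) that] by (simp add: \<sigma>_def c_def)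
  have cC: "c y \<in> ?C \<longleftrightarrow> y \<in> ?C" for y
    using permutes_in_image[OF cycle_permutes] unfolding c_def by metis
  have \<tau>B: "\<tau> y \<in> B \<longleftrightarrow> y \<in> B" for y using permutes_in_image[OF assms(3)] .
  have imB: "\<sigma> ` T = \<tau> ` T" if "T \<subseteq> B" for T
    using that assms(5) \<sigma>B by (intro image_cong) auto
  have imC: "\<sigma> ` T = c ` T" if "T \<subseteq> ?C" for T
    using that \<sigma>C by (intro image_cong) auto
  have cCC: "c ` ?C = ?C" unfolding c_def by (rule cycle_is_surj[OF assms(1)])
  have finV: "finite V" unfolding V_def using assms(4) by simp
  have inv_sets: "{S. S \<subseteq> ?C \<union> B \<and> \<sigma> ` S = S} = V \<union> (\<lambda>T. ?C \<union> T) ` V" (is "?L = ?R")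
  proof (intro equalityI subsetI)
    fix S assume "S \<in> ?L"
    then have S: "S \<subseteq> ?C \<union> B" "\<sigma> ` S = S" by auto
    have split: "S = (S \<inter> ?C) \<union> (S \<inter> B)" using S by auto
    have im: "\<sigma> ` S = c ` (S \<inter> ?C) \<union> \<tau> ` (S \<inter> B)"
      by (subst split, subst image_Un) (simp add: imB imC)
    have sub: "c ` (S \<inter> ?C) \<subseteq> ?C" "\<tau> ` (S \<inter> B) \<subseteq> B" using cC \<tau>B by auto
    have "c ` (S \<inter> ?C) = \<sigma> ` S \<inter> ?C" "\<tau> ` (S \<inter> B) = \<sigma> ` S \<inter> B"
      unfolding im using sub assms(5) by blast+
    then have SC: "c ` (S \<inter> ?C) = S \<inter> ?C" and SB: "S \<inter> B \<in> V"
      unfolding S(2) V_def by auto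
    from cycle_of_list_invariant_subset[OF assms(1), of "S \<inter> ?C"] SC
    consider "S \<inter> ?C = {}" | "S \<inter> ?C = ?C" unfolding c_def by auto
    then show "S \<in> ?R"
    proof cases
      case 1
      then have "S = S \<inter> B" using S(1) by auto
      then show ?thesis using SB by simp
    next
      case 2
      then have "S = ?C \<union> (S \<inter> B)" using S(1) by auto
      then show ?thesis using SB by blast
    qed
  next
    fix S assume "S \<in> ?R"
    then consider "S \<in> V" | T where "S = ?C \<union> T" "T \<in> V" by auto
    then show "S \<in> ?L"
    proof cases
      case 1
      then show ?thesis using imB by (auto simp: V_def)
    next
      case 2
      then show ?thesis using imB[of T] imC[of ?C] cCC by (auto simp: V_def image_Un)
    qed
  qed
  have disj: "V \<inter> (\<lambda>T. ?C \<union> T) ` V = {}"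
  proof -
    \<comment> \<open>As \<open>cs\<close> is nonempty, its head separates the sets with the cycle
      from those without it.\<close>
    have "hd cs \<notin> T" if "T \<in> V" for T
      using that hd_in_set[OF assms(2)] assms(5) unfolding V_def by blast
    then show ?thesis using hd_in_set[OF assms(2)] by blast
  qed
  have inj: "inj_on (\<lambda>T. ?C \<union> T) V"
  proof (rule inj_onI)
    fix T T' assume T: "T \<in> V" "T' \<in> V" and eq: "?C \<union> T = ?C \<union> T'"
    have "(?C \<union> T) \<inter> B = T" "(?C \<union> T') \<inter> B = T'" using T assms(5) by (auto simp: V_def)
    then show "T = T'" using eq by metis
  qed
  have restrB: "restrict_perm \<sigma> T = restrict_perm \<tau> T" if "T \<in> V" for T
  proof
    fix y
    show "restrict_perm \<sigma> T y = restrict_perm \<tau> T y"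
      using that assms(5) \<sigma>B[of y] by (auto simp: V_def restrict_perm_def)
  qed
  have restrC: "restrict_perm \<sigma> (?C \<union> T) = c \<circ> restrict_perm \<tau> T" if "T \<in> V" for T
  proof
    fix y
    have out: "c z = z" if "z \<notin> ?C" for z using id_outside_supp[OF that] by (simp add: c_def)
    consider "y \<in> ?C" "y \<notin> T" | "y \<in> T" "y \<notin> ?C" "\<tau> y \<notin> ?C" | "y \<notin> ?C" "y \<notin> T"
      using \<open>T \<in> V\<close> assms(5) \<tau>B[of y] unfolding V_def by blast
    then show "restrict_perm \<sigma> (?C \<union> T) y = (c \<circ> restrict_perm \<tau> T) y"
      using out \<sigma>B[of y] \<sigma>C[of y] by cases (simp_all add: restrict_perm_def)
  qed
  have finT: "finite T" if "T \<in> V" for T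
    using that assms(4) unfolding V_def by (blast intro: finite_subset)
  have card: "card (?C \<union> T) = length cs + card T" if "T \<in> V" for T
  proof -
    have "?C \<inter> T = {}" using that assms(5) unfolding V_def by blast
    then show ?thesis
      using finT[OF that] by (simp add: card_Un_disjoint distinct_card[OF assms(1)])
  qed
  have sgn: "sign (c \<circ> restrict_perm \<tau> T) = (-1) ^ (length cs - 1) * sign (restrict_perm \<tau> T)"
    if "T \<in> V" for T
  proof -
    have "restrict_perm \<tau> T permutes T"
      using that restrict_perm_permutes[OF assms(3), of T] by (simp add: V_def)
    then have "permutation (restrict_perm \<tau> T)"
      using finT[OF that] unfolding permutation_permutes by blast
    then show ?thesis
      unfolding c_def by (simp add: sign_compose permutation_of_cycle sign_cycle_of_list assms)
  qed
  have neg: "(-1) ^ (length cs - 1) * (- x) ^ length cs = - (x ^ length cs)"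
  proof -
    obtain m where m: "length cs = Suc m" using assms(2) by (cases cs) auto
    have "(-1) ^ m * (- x) ^ m = x ^ m" by (simp flip: power_mult_distrib)
    then have "- x * ((-1) ^ m * (- x) ^ m) = - (x ^ Suc m)" by simp
    then show ?thesis unfolding m by (simp add: mult_ac)
  qed
  have "cycle_poly (?C \<union> B) \<sigma> x =
      (\<Sum>T\<in>V. of_int (sign (restrict_perm \<sigma> T)) * (- x) ^ card T) +
      (\<Sum>T\<in>V. of_int (sign (restrict_perm \<sigma> (?C \<union> T))) * (- x) ^ card (?C \<union> T))"
    unfolding cycle_poly_def inv_sets
    using finV disj inj by (simp add: sum.union_disjoint sum.reindex)
  also have "\<dots> = (\<Sum>T\<in>V. of_int (sign (restrict_perm \<tau> T)) * (- x) ^ card T) +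
      (\<Sum>T\<in>V. - (x ^ length cs) * (of_int (sign (restrict_perm \<tau> T)) * (- x) ^ card T))"
  proof (intro arg_cong2[where f = "(+)"] sum.cong refl)
    fix T assume T: "T \<in> V"
    have "of_int (sign (restrict_perm \<sigma> (?C \<union> T))) * (- x) ^ card (?C \<union> T) =
        ((-1) ^ (length cs - 1) * (- x) ^ length cs) * (of_int (sign (restrict_perm \<tau> T)) * (- x) ^ card T)"
      unfolding restrC[OF T] sgn[OF T] card[OF T] by (simp add: power_add mult_ac)
    then show "of_int (sign (restrict_perm \<sigma> (?C \<union> T))) * (- x) ^ card (?C \<union> T) =
       - (x ^ length cs) * (of_int (sign (restrict_perm \<tau> T)) * (- x) ^ card T)"
      unfolding neg .
  qed (simp add: restrB)
  also have "\<dots> = (1 - x ^ length cs) * cycle_poly B \<tau> x"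
    unfolding cycle_poly_def V_def by (simp only: sum_distrib_left[symmetric]) (simp add: algebra_simps)
  finally show ?thesis unfolding \<sigma>_def c_def .
qed

section \<open>Splitting a permutation along the cycle through a point\<close>

lemma support_cycle_compose:
  assumes "distinct (p # l)" "\<tau> permutes B" "set (p # l) \<inter> B = {}"
  shows "support (cycle_of_list (p # l) \<circ> \<tau>) p = p # l"
proof -
  let ?cs = "p # l"
  define \<sigma> where "\<sigma> = cycle_of_list ?cs \<circ> \<tau>"
  have pow: "(\<sigma> ^^ i) p = ?cs ! (i mod length ?cs)" for i
  proof (induction i)
    case (Suc i)
    have "?cs ! (i mod length ?cs) \<in> set ?cs" by (rule nth_mem) simp
    then have "(\<sigma> ^^ Suc i) p = cycle_of_list ?cs (?cs ! (i mod length ?cs))"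
      using cycle_compose_apply(1)[OF assms(2,3)] Suc unfolding \<sigma>_def
      by (metis comp_apply funpow.simps(2))
    also have "\<dots> = ?cs ! ((i mod length ?cs + 1) mod length ?cs)"
      using funpow_cycle_of_list_nth[OF assms(1), of "i mod length ?cs" 1] by simp
    finally show ?case by (simp add: mod_Suc_eq)
  qed simp
  \<comment> \<open>An earlier return to \<open>p\<close> would repeat the head of the distinct list
    \<open>?cs\<close>.\<close>
  have "least_power \<sigma> p = length ?cs"
    unfolding least_power_def
  proof (rule Least_equality)
    show "(\<sigma> ^^ length ?cs) p = p \<and> 0 < length ?cs" by (simp add: pow del: funpow.simps)
  next
    fix n assume n: "(\<sigma> ^^ n) p = p \<and> 0 < n"
    show "length ?cs \<le> n"
    proof (rule ccontr)
      assume "\<not> length ?cs \<le> n"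
      then have "?cs ! n = ?cs ! 0" "n < length ?cs" using n pow[of n] by auto
      then show False using n nth_eq_iff_index_eq[OF assms(1), of n 0] by simp
    qed
  qed
  then have "support \<sigma> p = map (\<lambda>i. ?cs ! (i mod length ?cs)) [0..<length ?cs]"
    by (simp only: pow)
  also have "\<dots> = map (\<lambda>i. ?cs ! i) [0..<length ?cs]" by (intro map_cong) auto
  also have "\<dots> = ?cs" by (rule map_nth)
  finally show ?thesis unfolding \<sigma>_def .
qed

text \<open>Together with \<open>support_cycle_compose\<close> this makes splitting off the orbit of
  \<open>p\<close> and composing with a cycle inverse to each other.\<close>

lemma cycle_compose_restrict_perm:
  assumes "\<sigma> permutes A" "finite A" 
  shows "cycle_of_list (support \<sigma> p) \<circ> restrict_perm \<sigma> (A - set (support \<sigma> p)) = \<sigma>"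
proof
  fix a
  have perm: "permutation \<sigma>" using assms unfolding permutation_permutes by blast
  consider "a \<in> A - set (support \<sigma> p)" | "a \<in> set (support \<sigma> p)" | "a \<notin> A" "a \<notin> set (support \<sigma> p)"
    by blast
  then show "(cycle_of_list (support \<sigma> p) \<circ> restrict_perm \<sigma> (A - set (support \<sigma> p))) a = \<sigma> a"
  proof cases
    case 1
    \<comment> \<open>The point \<open>\<sigma> a\<close> lies in the orbit of \<open>a\<close>,
      which is disjoint from that of \<open>p\<close>.\<close>
    have "(\<sigma> ^^ 1) a \<in> set (support \<sigma> a)"
      unfolding support_set[OF perm] by blast
    with 1 have "\<sigma> a \<notin> set (support \<sigma> p)"
      using disjoint_support'[OF perm, of a p] by auto
    with 1 show ?thesis
      using id_outside_supp[of _ "support \<sigma> p"] unfolding restrict_perm_def by simp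
  next
    case 2
    then show ?thesis
      using cycle_restrict[OF perm 2] unfolding restrict_perm_def by simp
  next
    case 3
    then show ?thesis
      using id_outside_supp[OF 3(2)] permutes_not_in[OF assms(1)] unfolding restrict_perm_def by simp
  qed
qed

text \<open>The cycle through \<open>p\<close> is recorded by the list of its elements after \<open>p\<close>.\<close>

lemma sum_permutations_by_cycle:
  fixes F :: "('a \<Rightarrow> 'a) \<Rightarrow> 'b :: comm_monoid_add"
  assumes A: "finite A" and p: "p \<in> A"
  shows "(\<Sum>\<sigma> | \<sigma> permutes A. F \<sigma>) =
    (\<Sum>l | distinct l \<and> set l \<subseteq> A - {p}.
       \<Sum>\<tau> | \<tau> permutes (A - {p} - set l). F (cycle_of_list (p # l) \<circ> \<tau>))"
proof -
  define L where "L = {l. distinct l \<and> set l \<subseteq> A - {p}}"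
  have finL: "finite L"
  proof (rule finite_subset)
    show "L \<subseteq> {l. set l \<subseteq> A \<and> length l \<le> card A}"
    proof clarify
      fix l assume "l \<in> L"
      then have l: "distinct l" "set l \<subseteq> A" by (auto simp: L_def)
      show "set l \<subseteq> A \<and> length l \<le> card A"
        using l card_mono[OF A l(2)] distinct_card[OF l(1)] by simp
    qed
    show "finite {l. set l \<subseteq> A \<and> length l \<le> card A}" using A by (rule finite_lists_length_le)
  qed
  have "(\<Sum>l\<in>L. \<Sum>\<tau> | \<tau> permutes (A - {p} - set l). F (cycle_of_list (p # l) \<circ> \<tau>)) =
      (\<Sum>(l, \<tau>)\<in>(SIGMA l:L. {\<tau>. \<tau> permutes (A - {p} - set l)}). F (cycle_of_list (p # l) \<circ> \<tau>))"
    using finL A by (subst sum.Sigma) (auto simp: finite_permutations)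
  also have "\<dots> = (\<Sum>\<sigma> | \<sigma> permutes A. F \<sigma>)"
  \<comment> \<open>The inverse direction reads off the orbit of \<open>p\<close> without its head
    \<open>p\<close>, and the action off that orbit.\<close>
  proof (rule sum.reindex_bij_witness[where
      i = "\<lambda>\<sigma>. (tl (support \<sigma> p), restrict_perm \<sigma> (A - set (support \<sigma> p)))" and
      j = "\<lambda>(l, \<tau>). cycle_of_list (p # l) \<circ> \<tau>"])
    fix z assume "z \<in> (SIGMA l:L. {\<tau>. \<tau> permutes (A - {p} - set l)})"
    then obtain l \<tau> where z: "z = (l, \<tau>)" and l: "l \<in> L" and \<tau>: "\<tau> permutes (A - {p} - set l)"
      by blast
    have d: "distinct (p # l)" using l by (auto simp: L_def)
    have disj: "set (p # l) \<inter> (A - {p} - set l) = {}" by auto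
    have sup: "support (cycle_of_list (p # l) \<circ> \<tau>) p = p # l"
      by (rule support_cycle_compose[OF d \<tau> disj])
    have "restrict_perm (cycle_of_list (p # l) \<circ> \<tau>) (A - set (p # l)) = \<tau>"
    proof
      fix x
      have "x \<in> A - set (p # l) \<longleftrightarrow> x \<in> A - {p} - set l" by auto
      then show "restrict_perm (cycle_of_list (p # l) \<circ> \<tau>) (A - set (p # l)) x = \<tau> x"
        using cycle_compose_apply(2)[OF \<tau> disj, of x] permutes_not_in[OF \<tau>, of x]
        unfolding restrict_perm_def by (metis DiffD2)
    qed
    then show "(tl (support (case z of (l, \<tau>) \<Rightarrow> cycle_of_list (p # l) \<circ> \<tau>) p),
        restrict_perm (case z of (l, \<tau>) \<Rightarrow> cycle_of_list (p # l) \<circ> \<tau>)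
          (A - set (support (case z of (l, \<tau>) \<Rightarrow> cycle_of_list (p # l) \<circ> \<tau>) p))) = z"
      unfolding z prod.case sup by simp
    have "set (p # l) \<subseteq> A" using l p by (auto simp: L_def)
    then have "cycle_of_list (p # l) permutes A"
      using cycle_permutes permutes_subset by blast
    moreover have "\<tau> permutes A" using \<tau> by (rule permutes_subset) auto
    ultimately show "(case z of (l, \<tau>) \<Rightarrow> cycle_of_list (p # l) \<circ> \<tau>) \<in> {\<sigma>. \<sigma> permutes A}"
      unfolding z prod.case mem_Collect_eq by (rule permutes_compose[rotated])
    show "F (case z of (l, \<tau>) \<Rightarrow> cycle_of_list (p # l) \<circ> \<tau>) =
        (case z of (l, \<tau>) \<Rightarrow> F (cycle_of_list (p # l) \<circ> \<tau>))"
      by (simp add: z)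
  next
    fix \<sigma> assume "\<sigma> \<in> {\<sigma>. \<sigma> permutes A}"
    then have \<sigma>: "\<sigma> permutes A" by simp
    have perm: "permutation \<sigma>" using \<sigma> A unfolding permutation_permutes by blast
    have pos: "least_power \<sigma> p > 0" by (rule least_power_of_permutation(2)[OF perm])
    have sup_tl: "support \<sigma> p = p # tl (support \<sigma> p)"
      using pos by (cases "least_power \<sigma> p") (simp_all add: upt_conv_Cons del: upt_Suc)
    define l where "l = tl (support \<sigma> p)"
    have sup: "support \<sigma> p = p # l" unfolding l_def by (fact sup_tl)
    have dist: "distinct (p # l)" using cycle_of_permutation[OF perm, of p] unfolding sup .
    have "set (support \<sigma> p) \<subseteq> A"
      using p permutes_in_image[OF permutes_funpow[OF \<sigma>]] by auto
    then have sub: "set (p # l) \<subseteq> A" unfolding sup .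
    have eq: "A - {p} - set l = A - set (p # l)" by auto
    show "(tl (support \<sigma> p), restrict_perm \<sigma> (A - set (support \<sigma> p)))
        \<in> (SIGMA l:L. {\<tau>. \<tau> permutes (A - {p} - set l)})"
      using semidecomposition[OF \<sigma> A, of p] dist sub
      unfolding L_def restrict_perm_def mem_Sigma_iff sup list.sel eq by auto
    show "(case (tl (support \<sigma> p), restrict_perm \<sigma> (A - set (support \<sigma> p))) of
        (l, \<tau>) \<Rightarrow> cycle_of_list (p # l) \<circ> \<tau>) = \<sigma>"
      using cycle_compose_restrict_perm[OF \<sigma> A, of p] unfolding sup by simp
  qed
  finally show ?thesis unfolding L_def ..
qed

section \<open>The recurrence for the coefficients\<close>

text \<open>Over a field a series without constant term has inverse 0, so \<open>inverse\<close> is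
  multiplicative even on non-units.\<close>

lemma fps_power_int_mult_distrib:
  fixes f g :: "'a :: field fps"
  shows "(f * g) powi r = f powi r * g powi r"
  by (simp add: power_int_def power_mult_distrib fps_inverse_mult)

lemma fps_of_poly_of_int: "fps_of_poly (of_int k :: 'a :: comm_ring_1 poly) = of_int k"
  by (rule fps_ext) (simp add: of_int_poly fps_of_int[symmetric] coeff_pCons split: nat.splits)

lemma fps_of_poly_cycle_poly:
  "fps_of_poly (cycle_poly A \<sigma> [:0, 1:] :: 'a :: comm_ring_1 poly) = cycle_poly A \<sigma> fps_X"
proof -
  have "fps_of_poly (- [:0, 1:] :: 'a poly) = - fps_X"
    by (simp only: fps_of_poly_uminus fps_of_poly_fps_X)
  then show ?thesis
    unfolding cycle_poly_def
    by (simp only: fps_of_poly_sum fps_of_poly_mult fps_of_poly_power fps_of_poly_of_int)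
qed

text \<open>The index set is arbitrary because removing a cycle from \<open>{..<n}\<close> need not
  leave an initial segment.\<close>

definition perm_sum :: "int \<Rightarrow> 'a set \<Rightarrow> complex fps" where
  "perm_sum r A = (\<Sum>\<sigma> | \<sigma> permutes A. cycle_poly A \<sigma> fps_X powi r)"

lemma perm_sum_empty: "perm_sum r ({} :: 'a set) = 1"
proof -
  have "{S :: 'a set. S \<subseteq> {} \<and> id ` S = S} = {{}}" by auto
  then have "cycle_poly ({} :: 'a set) id (fps_X :: complex fps) = 1"
    unfolding cycle_poly_def by (simp add: restrict_perm_def sign_id flip: id_def)
  then show ?thesis by (simp add: perm_sum_def power_int_def fps_inverse_one)
qed

lemma perm_sum_by_cycle:
  assumes "finite A" "p \<in> A"
  shows "perm_sum r A = (\<Sum>l | distinct l \<and> set l \<subseteq> A - {p}.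
           (1 - fps_X ^ Suc (length l)) powi r * perm_sum r (A - {p} - set l))"
  unfolding perm_sum_def sum_permutations_by_cycle[OF assms] sum_distrib_left
proof (intro sum.cong refl)
  fix l \<tau> assume l: "l \<in> {l. distinct l \<and> set l \<subseteq> A - {p}}"
    and "\<tau> \<in> {\<tau>. \<tau> permutes (A - {p} - set l)}"
  then have \<tau>: "\<tau> permutes (A - {p} - set l)" by simp
  have A: "set (p # l) \<union> (A - {p} - set l) = A" using l assms(2) by auto
  have "cycle_poly A (cycle_of_list (p # l) \<circ> \<tau>) fps_X =
      (1 - fps_X ^ length (p # l)) * cycle_poly (A - {p} - set l) \<tau> (fps_X :: complex fps)"
    using cycle_poly_cycle_compose[of "p # l" \<tau> "A - {p} - set l" fps_X] l \<tau> assms(1)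
    unfolding A by auto
  then show "cycle_poly A (cycle_of_list (p # l) \<circ> \<tau>) fps_X powi r =
      (1 - fps_X ^ Suc (length l)) powi r *
      cycle_poly (A - {p} - set l) \<tau> (fps_X :: complex fps) powi r"
    by (simp add: fps_power_int_mult_distrib)
qed

lemma card_distinct_lists_subset:
  assumes "finite B" "k \<le> card B"
  shows "card {l. (distinct l \<and> set l \<subseteq> B) \<and> length l = k} = fact (card B) div fact (card B - k)"
proof -
  have "{l. (distinct l \<and> set l \<subseteq> B) \<and> length l = k} = {l. length l = k \<and> distinct l \<and> set l \<subseteq> B}"
    by auto
  then show ?thesis
    using card_lists_distinct_length_eq[OF assms] fact_div_fact[of "card B - k" "card B"] by simp
qed

text \<open>If k other points share the cycle of the chosen point, they can be listed in n!/(n-k)!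
  ways. The hypothesis on proper subsets lets the lemma serve both as the inductive step of
  \<open>perm_sum_eq_card\<close> and as the source of the recurrence.\<close>

lemma perm_sum_Suc:
  assumes "finite A" "card A = Suc n"
    and IH: "\<And>B. B \<subset> A \<Longrightarrow> perm_sum r B = f (card B)"
  shows "perm_sum r A = (\<Sum>k\<le>n. of_nat (fact n div fact (n - k)) * ((1 - fps_X ^ Suc k) powi r * f (n - k)))"
proof -
  obtain p where p: "p \<in> A" using assms(2) by fastforce
  let ?B = "A - {p}"
  have B: "finite ?B" "card ?B = n" using assms(1,2) p by auto
  let ?L = "{l. distinct l \<and> set l \<subseteq> ?B}"
  have len: "length l \<le> n" and crd: "card (A - {p} - set l) = n - length l" if "l \<in> ?L" for l
    using that card_mono[OF B(1), of "set l"] distinct_card[of l] B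
    by (auto simp: card_Diff_subset)
  have fin: "finite ?L"
  proof (rule finite_subset)
    show "?L \<subseteq> {l. set l \<subseteq> ?B \<and> length l \<le> n}" using len by auto
  qed (rule finite_lists_length_le[OF B(1)])
  have "perm_sum r A = (\<Sum>l\<in>?L. (1 - fps_X ^ Suc (length l)) powi r * f (n - length l))"
    unfolding perm_sum_by_cycle[OF assms(1) p]
  proof (intro sum.cong refl)
    fix l assume l: "l \<in> ?L"
    have "A - {p} - set l \<subset> A" using p by auto
    from IH[OF this] show "(1 - fps_X ^ Suc (length l)) powi r * perm_sum r (A - {p} - set l) =
        (1 - fps_X ^ Suc (length l)) powi r * f (n - length l)"
      by (simp add: crd[OF l])
  qed
  also have "\<dots> = (\<Sum>k\<le>n. \<Sum>l | l \<in> ?L \<and> length l = k. (1 - fps_X ^ Suc (length l)) powi r * f (n - length l))"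
    using len by (subst sum.group[OF fin]) auto
  also have "\<dots> = (\<Sum>k\<le>n. of_nat (fact n div fact (n - k)) * ((1 - fps_X ^ Suc k) powi r * f (n - k)))"
  proof (intro sum.cong refl)
    fix k assume k: "k \<in> {..n}"
    have "(\<Sum>l | l \<in> ?L \<and> length l = k. (1 - fps_X ^ Suc (length l)) powi r * f (n - length l)) =
        (\<Sum>l | l \<in> ?L \<and> length l = k. (1 - fps_X ^ Suc k) powi r * f (n - k))"
      by (intro sum.cong) auto
    also have "\<dots> = of_nat (card {l. l \<in> ?L \<and> length l = k}) * ((1 - fps_X ^ Suc k) powi r * f (n - k))"
      by simp
    also have "card {l. l \<in> ?L \<and> length l = k} = fact n div fact (n - k)"
      using card_distinct_lists_subset[OF B(1), of k] k unfolding B(2) by simp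
    finally show "(\<Sum>l | l \<in> ?L \<and> length l = k. (1 - fps_X ^ Suc (length l)) powi r * f (n - length l)) =
        of_nat (fact n div fact (n - k)) * ((1 - fps_X ^ Suc k) powi r * f (n - k))" .
  qed
  finally show ?thesis .
qed

text \<open>By strong induction, \<open>perm_sum_Suc\<close> expands both sides into the same sum
  over values at initial segments.\<close>

lemma perm_sum_eq_card:
  fixes A :: "nat set"
  assumes "finite A"
  shows "perm_sum r A = perm_sum r {..<card A}"
  using assms
proof (induction "card A" arbitrary: A rule: less_induct)
  case less
  have hyp: "perm_sum r C = perm_sum r {..<card C}"
    if "finite B" "card B = card A" "C \<subset> B" for B C :: "nat set"
    using less.hyps[of C] that psubset_card_mono[OF that(1,3)] finite_subset[of C B] by auto
  show ?case
  proof (cases "card A")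
    case 0
    then show ?thesis using less.prems by (simp add: perm_sum_empty)
  next
    case (Suc n)
    show ?thesis
      using perm_sum_Suc[OF less.prems Suc, of r "\<lambda>m. perm_sum r {..<m}"]
        perm_sum_Suc[of "{..<card A}" n r "\<lambda>m. perm_sum r {..<m}"]
        hyp[OF less.prems] hyp[of "{..<card A}"] Suc by simp
  qed
qed

definition perm_average :: "int \<Rightarrow> nat \<Rightarrow> complex fps" where
  "perm_average r n = fps_const (1 / fact n) * perm_sum r {..<n}"

lemma Phi_nth: "fps_nth (Phi r) n = perm_average r n"
proof (cases n)
  case 0
  \<comment> \<open>The separate 1 in \<open>Phi\<close> is the contribution of the only permutation
    of the empty set.\<close>
  then show ?thesis by (simp add: Phi_def perm_average_def perm_sum_empty)
next
  case (Suc m)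
  have "fps_nth (Phi r) n = (\<Sum>\<sigma> | \<sigma> permutes {..<n}.
      fps_const (1 / fact n) * fps_of_poly (det_one_minus_x_perm n \<sigma>) powi r)"
    unfolding Phi_def using Suc by simp
  also have "\<dots> = perm_average r n"
    unfolding perm_average_def perm_sum_def sum_distrib_left
    by (intro sum.cong refl) (simp add: det_one_minus_x_perm_eq_cycle_poly fps_of_poly_cycle_poly)
  finally show ?thesis .
qed

lemma perm_average_0: "perm_average r 0 = 1"
  by (simp add: perm_average_def perm_sum_empty)

text \<open>The number of lists and the normalisation cancel: (n+1)/(n+1)! times n!/(n-k)! is
  1/(n-k)!, the factor in the smaller average. The index \<open>k\<close> is the cycle length less
  one.\<close>

lemma perm_average_recurrence:
  "of_nat (Suc n) * perm_average r (Suc n) =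
     (\<Sum>k\<le>n. (1 - fps_X ^ Suc k) powi r * perm_average r (n - k))"
proof -
  have "perm_sum r {..<Suc n} = (\<Sum>k\<le>n. of_nat (fact n div fact (n - k)) *
          ((1 - fps_X ^ Suc k) powi r * perm_sum r {..<n - k}))"
    by (rule perm_sum_Suc) (auto intro: perm_sum_eq_card finite_subset)
  then have "of_nat (Suc n) * perm_average r (Suc n) = 
     (\<Sum>k\<le>n. (of_nat (Suc n) * fps_const (1 / fact (Suc n)) * of_nat (fact n div fact (n - k))) *
        ((1 - fps_X ^ Suc k) powi r * perm_sum r {..<n - k}))"
    unfolding perm_average_def by (simp only: sum_distrib_left mult_ac)
  also have "\<dots> = (\<Sum>k\<le>n. (1 - fps_X ^ Suc k) powi r * perm_average r (n - k))"
  proof (intro sum.cong refl)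
    fix k assume "k \<in> {..n}"
    have "(of_nat (fact n div fact (n - k)) :: complex) = fact n / fact (n - k)"
    proof -
      have "fact n = fact (n - k) * (fact n div fact (n - k) :: nat)"
        by (simp add: fact_dvd)
      then have "(fact n :: complex) = fact (n - k) * of_nat (fact n div fact (n - k))"
        by (metis of_nat_fact of_nat_mult)
      then show ?thesis by (simp add: field_simps)
    qed
    then have "of_nat (Suc n) * fps_const (1 / fact (Suc n)) * of_nat (fact n div fact (n - k)) =
        fps_const (of_nat (Suc n) * (1 / fact (Suc n)) * (fact n / fact (n - k)) :: complex)"
      by (metis fps_of_nat fps_const_mult)
    also have "of_nat (Suc n) * (1 / fact (Suc n)) * (fact n / fact (n - k)) = (1 / fact (n - k) :: complex)"
      by (simp add: fact_Suc field_simps del: of_nat_Suc)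
    finally show "of_nat (Suc n) * fps_const (1 / fact (Suc n)) * of_nat (fact n div fact (n - k)) *
        ((1 - fps_X ^ Suc k) powi r * perm_sum r {..<n - k}) =
        (1 - fps_X ^ Suc k) powi r * perm_average r (n - k)"
      unfolding perm_average_def by (simp only: mult_ac)
  qed
  finally show ?thesis .
qed

section \<open>The product of linear factors\<close>

definition fps_agree :: "nat \<Rightarrow> 'a fps \<Rightarrow> 'a fps \<Rightarrow> bool" where
  "fps_agree N f g \<longleftrightarrow> (\<forall>m\<le>N. fps_nth f m = fps_nth g m)"

lemma fps_agree_refl [simp]: "fps_agree N f f"
  and fps_agree_sym: "fps_agree N f g \<Longrightarrow> fps_agree N g f"
  and fps_agree_trans [trans]: "fps_agree N f g \<Longrightarrow> fps_agree N g h \<Longrightarrow> fps_agree N f h"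
  by (simp_all add: fps_agree_def)

lemma fps_agree_sum:
  "(\<And>i. i \<in> I \<Longrightarrow> fps_agree N (f i) (g i)) \<Longrightarrow> fps_agree N (sum f I) (sum g I)"
  by (simp add: fps_agree_def fps_sum_nth)

lemma fps_agree_mult:
  "fps_agree N f f' \<Longrightarrow> fps_agree N g g' \<Longrightarrow> fps_agree N (f * g) (f' * g')"
  for f :: "'a :: semiring_0 fps"
  by (auto simp: fps_agree_def fps_mult_nth intro!: sum.cong)

lemma fps_agree_prod:
  "(\<And>i. i \<in> I \<Longrightarrow> fps_agree N (f i) (g i)) \<Longrightarrow> fps_agree N (prod f I) (prod g I)"
  for f :: "'i \<Rightarrow> 'a :: comm_semiring_1 fps"
  by (induction I rule: infinite_finite_induct) (auto intro: fps_agree_mult)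

lemma fps_agree_power: "fps_agree N f g \<Longrightarrow> fps_agree N (f ^ n) (g ^ n)"
  for f :: "'a :: comm_semiring_1 fps"
  by (induction n) (auto intro: fps_agree_mult)

text \<open>\<open>geom_y j\<close> is the series \<open>1 / (1 - x\<^sup>j y)\<close> and \<open>factor_y j e\<close> is \<open>(1 - x\<^sup>j y)\<close> to the power \<open>-e\<close>.
  They are given explicitly because \<open>powi\<close> obeys few laws over a coefficient ring which is not a field.\<close>

definition geom_y :: "nat \<Rightarrow> complex fps fps" where
  "geom_y j = Abs_fps (\<lambda>n. fps_X ^ (j * n))"

text \<open>The \<open>fps_X\<close> under \<open>fps_const\<close> is x; the outer one is
  y.\<close>

definition lin_y :: "nat \<Rightarrow> complex fps fps" where
  "lin_y j = 1 - fps_const (fps_X ^ j) * fps_X"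

lemma lin_y_nth: "fps_nth (lin_y j) n = (if n = 0 then 1 else if n = 1 then - (fps_X ^ j) else 0)"
  by (simp add: lin_y_def)

lemma lin_geom: "lin_y j * geom_y j = 1"
proof (rule fps_ext)
  fix n
  have "fps_nth (lin_y j * geom_y j) n = fps_nth (geom_y j) n -
          (if n = 0 then 0 else fps_X ^ j * fps_nth (geom_y j) (n - 1))"
    by (simp add: lin_y_def left_diff_distrib mult.assoc)
  then show "fps_nth (lin_y j * geom_y j) n = fps_nth 1 n"
    by (cases n) (simp_all add: geom_y_def power_add)
qed

definition factor_y :: "nat \<Rightarrow> int \<Rightarrow> complex fps fps" where
  "factor_y j e = (if e \<ge> 0 then geom_y j ^ nat e else lin_y j ^ nat (- e))"

text \<open>The operator y d/dy. It multiplies the coefficient of y^n by n, as on the left side of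
  the recurrence.\<close>

definition euler :: "'a :: comm_ring_1 fps \<Rightarrow> 'a fps" where
  "euler f = fps_X * fps_deriv f"

lemma euler_nth: "fps_nth (euler f) n = of_nat n * fps_nth f n"
  by (cases n) (simp_all add: euler_def)

lemma euler_mult: "euler (f * g) = f * euler g + euler f * g"
  by (simp add: euler_def algebra_simps)

text \<open>The hypothesis states that \<open>l\<close> is the logarithmic derivative of
  \<open>f\<close>, in a form free of division.\<close>

lemma euler_power:
  assumes "euler f = l * f"
  shows "euler (f ^ n) = of_nat n * l * f ^ n"
proof (induction n)
  case (Suc n)
  then show ?case using assms by (simp add: euler_mult algebra_simps)
qed (simp add: euler_def)

lemma euler_prod:
  assumes "\<And>i. i \<in> I \<Longrightarrow> euler (f i) = l i * f i" "finite I"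
  shows "euler (prod f I) = sum l I * prod f I"
  using assms(2,1)
proof (induction I rule: finite_induct)
  case (insert i I)
  then show ?case by (simp add: euler_mult algebra_simps)
qed (simp add: euler_def)

lemma euler_lin: "euler (lin_y j) = - (geom_y j - 1) * lin_y j"
proof -
  have "euler (lin_y j) = lin_y j - 1"
    by (rule fps_ext) (simp add: euler_nth lin_y_nth)
  then show ?thesis using lin_geom[of j] by (simp add: algebra_simps)
qed

text \<open>Differentiate \<open>lin_geom\<close> and cancel \<open>lin_y j\<close> by multiplying
  with its inverse \<open>geom_y j\<close>.\<close>

lemma euler_geom: "euler (geom_y j) = (geom_y j - 1) * geom_y j"
proof -
  have "0 = euler (lin_y j * geom_y j)" by (simp add: lin_geom euler_def)
  also have "\<dots> = lin_y j * euler (geom_y j) - (geom_y j - 1) * (lin_y j * geom_y j)"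
    by (simp add: euler_mult euler_lin algebra_simps)
  finally have "lin_y j * euler (geom_y j) = geom_y j - 1" by (simp add: lin_geom)
  moreover have "euler (geom_y j) = (lin_y j * geom_y j) * euler (geom_y j)" by (simp add: lin_geom)
  ultimately show ?thesis by (simp only: mult_ac)
qed

lemma euler_factor: "euler (factor_y j e) = of_int e * (geom_y j - 1) * factor_y j e"
proof (cases "e \<ge> 0")
  case True
  then show ?thesis
    using euler_power[OF euler_geom[of j], of "nat e"] by (simp add: factor_y_def)
next
  case False
  then show ?thesis
    using euler_power[OF euler_lin[of j], of "nat (- e)"]
    by (simp add: factor_y_def algebra_simps)
qed

lemma factor_y_0: "fps_nth (factor_y j e) 0 = 1"
  by (simp add: factor_y_def fps_power_zeroth geom_y_def lin_y_def)

text \<open>The recurrence determines each term from the earlier ones, since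
  \<open>of_nat (Suc n)\<close> is invertible over the complex numbers; congruence therefore
  propagates.\<close>

lemma recurrence_agree:
  fixes a b f g :: "nat \<Rightarrow> complex fps"
  assumes "a 0 = 1" "b 0 = 1"
    and "\<And>n. of_nat (Suc n) * a (Suc n) = (\<Sum>k\<le>n. f k * a (n - k))"
    and "\<And>n. of_nat (Suc n) * b (Suc n) = (\<Sum>k\<le>n. g k * b (n - k))"
    and "\<And>k. fps_agree N (f k) (g k)"
  shows "fps_agree N (a n) (b n)"
proof (induction n rule: less_induct)
  case (less n)
  show ?case
  proof (cases n)
    case 0
    then show ?thesis using assms(1,2) by simp
  next
    case (Suc m)
    have "fps_agree N (of_nat (Suc m) * a (Suc m)) (of_nat (Suc m) * b (Suc m))"
      unfolding assms(3,4) by (intro fps_agree_sum fps_agree_mult assms(5) less) (simp add: Suc)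
    then have "fps_agree N (fps_const (1 / of_nat (Suc m)) * (of_nat (Suc m) * a (Suc m)))
        (fps_const (1 / of_nat (Suc m)) * (of_nat (Suc m) * b (Suc m)))"
      by (rule fps_agree_mult[OF fps_agree_refl])
    moreover have "fps_const (1 / of_nat (Suc m)) * (of_nat (Suc m) * h) = h" for h :: "complex fps"
      by (simp add: fps_of_nat[symmetric] mult.assoc[symmetric] del: of_nat_Suc)
    ultimately show ?thesis unfolding Suc by (simp only:)
  qed
qed

text \<open>The coefficients of \<open>(1 - x)\<^sup>r\<close>, which are also the exponents in the product formula.\<close>

definition exponent :: "int \<Rightarrow> nat \<Rightarrow> int" where
  "exponent r j = int_binomial (int j - r - 1) j"

lemma exponent_0: "exponent r 0 = 1"
  by (simp add: exponent_def int_binomial_def)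

text \<open>Upper negation of binomial coefficients identifies the exponents of the product with the
  coefficients of (1-x)^r.\<close>

lemma of_int_exponent:
  "of_int (exponent r j) = (-1) ^ j * (of_int r gchoose j :: 'a :: field_char_0)"
  unfolding exponent_def of_int_int_binomial gbinomial_negated_upper[of "of_int r"]
  by (simp flip: mult.assoc power_mult_distrib)

lemma one_minus_X_power_int: "(1 - fps_X :: complex fps) powi r = Abs_fps (\<lambda>j. of_int (exponent r j))"
proof -
  have "(1 - fps_X :: complex fps) powi r = fps_compose (fps_binomial (of_int r)) (- fps_const 1 * fps_X)"
  proof (cases "r \<ge> 0")
    case True
    then show ?thesis
      using one_minus_const_fps_X_power[of "1 :: complex" "nat r"] by (simp add: power_int_def)
  next
    case False
    then show ?thesis
      using one_minus_fps_X_const_neg_power[of "1 :: complex" "nat (- r)"]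
      by (simp add: power_int_def fps_inverse_power)
  qed
  then show ?thesis
    by (simp only: fps_const_neg fps_compose_linear) (simp add: fps_eq_iff of_int_exponent)
qed

lemma one_minus_X_power_power_int:
  assumes "k > 0"
  shows "(1 - fps_X ^ k :: complex fps) powi r = fps_compose ((1 - fps_X) powi r) (fps_X ^ k)"
proof -
  have 0: "fps_nth (fps_X ^ k :: complex fps) 0 = 0" using assms by simp
  have "fps_compose (1 - fps_X) (fps_X ^ k) = (1 - fps_X ^ k :: complex fps)"
    using 0 by (simp add: fps_compose_sub_distrib)
  moreover have "fps_nth (1 - fps_X :: complex fps) 0 \<noteq> 0" by simp
  ultimately show ?thesis
    using fps_inverse_compose[OF 0, of "1 - fps_X"]
    by (simp add: power_int_def fps_compose_power[OF 0, symmetric])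
qed

text \<open>Substitute x^k into the series of (1-x)^r; as k > 0, the terms with j > N have degree
  above N.\<close>

lemma one_minus_X_power_power_int_agree:
  assumes "k > 0"
  shows "fps_agree N ((1 - fps_X ^ k :: complex fps) powi r) (\<Sum>j\<le>N. of_int (exponent r j) * fps_X ^ (j * k))"
  unfolding fps_agree_def
proof (intro allI impI)
  fix m assume m: "m \<le> N"
  have "fps_nth ((1 - fps_X ^ k :: complex fps) powi r) m =
      (\<Sum>j\<le>m. of_int (exponent r j) * fps_nth (fps_X ^ (j * k)) m)"
    unfolding one_minus_X_power_power_int[OF assms] one_minus_X_power_int fps_compose_nth
    by (simp add: atLeast0AtMost mult.commute flip: power_mult)
  also have "\<dots> = (\<Sum>j\<le>N. of_int (exponent r j) * fps_nth (fps_X ^ (j * k)) m)"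
  proof (rule sum.mono_neutral_left)
    have "m \<noteq> j * k" if "j > m" for j
      using that assms by (metis One_nat_def Suc_leI less_le_not_le mult.right_neutral mult_le_mono2)
    then show "\<forall>j\<in>{..N} - {..m}. of_int (exponent r j) * fps_nth (fps_X ^ (j * k)) m = (0 :: complex)"
      by auto
  qed (use m in auto)
  finally show "fps_nth ((1 - fps_X ^ k :: complex fps) powi r) m =
      fps_nth (\<Sum>j\<le>N. of_int (exponent r j) * fps_X ^ (j * k)) m"
    by (simp add: fps_sum_nth fps_of_int[symmetric])
qed

text \<open>The dropped factors are 1 modulo x^(N+1), so no infinite product in two variables is
  needed.\<close>

definition truncated_Phi :: "nat \<Rightarrow> int \<Rightarrow> complex fps fps" where
  "truncated_Phi N r = (\<Prod>j\<le>N. factor_y j (exponent r j))"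

text \<open>The logarithmic derivatives of the factors add up to \<open>K\<close>, whose
  coefficients at positive powers of y are the truncations of (1-x^k)^r.\<close>

lemma truncated_Phi_recurrence:
  "of_nat (Suc n) * fps_nth (truncated_Phi N r) (Suc n) =
     (\<Sum>k\<le>n. (\<Sum>j\<le>N. of_int (exponent r j) * fps_X ^ (j * Suc k)) * fps_nth (truncated_Phi N r) (n - k))"
proof -
  define K where "K = (\<Sum>j\<le>N. of_int (exponent r j) * (geom_y j - 1))"
  have K: "fps_nth K k = (if k = 0 then 0 else \<Sum>j\<le>N. of_int (exponent r j) * fps_X ^ (j * k))" for k
    by (simp add: K_def fps_sum_nth geom_y_def fps_of_int[symmetric])
  have "euler (truncated_Phi N r) = K * truncated_Phi N r"
    unfolding truncated_Phi_def K_def by (intro euler_prod euler_factor) auto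
  then have "of_nat (Suc n) * fps_nth (truncated_Phi N r) (Suc n) = fps_nth (K * truncated_Phi N r) (Suc n)"
    by (metis euler_nth)
  \<comment> \<open>The coefficient of y^0 in \<open>K\<close> is 0, so the convolution starts at
    index 1; hence the shift to \<open>Suc k\<close>.\<close>
  also have "\<dots> = (\<Sum>k\<le>n. fps_nth K (Suc k) * fps_nth (truncated_Phi N r) (n - k))"
    unfolding fps_mult_nth
    by (simp add: sum.atMost_Suc_shift K[of 0] atLeast0AtMost del: sum.atMost_Suc sum.cl_ivl_Suc)
  finally show ?thesis by (simp add: K)
qed

lemma truncated_Phi_0: "fps_nth (truncated_Phi N r) 0 = 1"
proof -
  have "fps_nth (prod f I) 0 = 1" if "finite I" "\<And>i. fps_nth (f i) 0 = 1"
    for f :: "nat \<Rightarrow> complex fps fps" and I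
    using that by (induction I rule: finite_induct) auto
  then show ?thesis by (simp add: truncated_Phi_def factor_y_0)
qed

section \<open>The residue at 1\<close>

text \<open>Under this condition the substitution \<open>y = 1\<close> makes sense, and the first \<open>N\<close> terms of the series in
  \<open>y\<close> determine its result modulo \<open>x ^ Suc N\<close>.\<close>

definition y_degree_le_x :: "complex fps fps \<Rightarrow> bool" where
  "y_degree_le_x F \<longleftrightarrow> (\<forall>n m. m < n \<longrightarrow> fps_nth (fps_nth F n) m = 0)"

lemma mult_nth_eq_0:
  fixes f g :: "'a :: semiring_0 fps"
  assumes "\<And>k. k < i \<Longrightarrow> fps_nth f k = 0" "\<And>k. k < j \<Longrightarrow> fps_nth g k = 0" "m < i + j"
  shows "fps_nth (f * g) m = 0"
  unfolding fps_mult_nth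
proof (intro sum.neutral ballI)
  fix a assume "a \<in> {0..m}"
  then have "a < i \<or> m - a < j" using assms(3) by auto
  then show "fps_nth f a * fps_nth g (m - a) = 0" using assms(1,2) by auto
qed

lemma y_degree_le_x_mult:
  assumes "y_degree_le_x F" "y_degree_le_x G"
  shows "y_degree_le_x (F * G)"
  unfolding y_degree_le_x_def
proof (intro allI impI)
  fix n m :: nat assume "m < n"
  show "fps_nth (fps_nth (F * G) n) m = 0"
    unfolding fps_mult_nth[of F G] fps_sum_nth
  proof (intro sum.neutral ballI)
    fix i assume "i \<in> {0..n}"
    then show "fps_nth (fps_nth F i * fps_nth G (n - i)) m = 0"
      using assms \<open>m < n\<close>
      by (intro mult_nth_eq_0[where i = i and j = "n - i"]) (auto simp: y_degree_le_x_def)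
  qed
qed

lemma y_degree_le_x_1: "y_degree_le_x 1"
  by (simp add: y_degree_le_x_def)

lemma y_degree_le_x_power: "y_degree_le_x F \<Longrightarrow> y_degree_le_x (F ^ n)"
  by (induction n) (simp_all add: y_degree_le_x_1 y_degree_le_x_mult)

lemma y_degree_le_x_prod:
  "(\<And>i. i \<in> I \<Longrightarrow> y_degree_le_x (f i)) \<Longrightarrow> y_degree_le_x (prod f I)"
  by (induction I rule: infinite_finite_induct) (simp_all add: y_degree_le_x_1 y_degree_le_x_mult)

text \<open>Powers of y come only as powers of x^j y. For j = 0 the factor 1/(1-y) breaks the bound;
  it carries the pole.\<close>

lemma y_degree_le_x_factor:
  assumes "j > 0"
  shows "y_degree_le_x (factor_y j e)"
proof -
  have "m \<noteq> j * n" if "m < n" for m n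
    using that assms by (metis leD mult_le_mono1 Suc_leI One_nat_def nat_mult_1)
  then have "y_degree_le_x (geom_y j)" by (auto simp: y_degree_le_x_def geom_y_def)
  moreover have "y_degree_le_x (lin_y j)"
    using assms by (auto simp: y_degree_le_x_def lin_y_nth)
  ultimately show ?thesis by (simp add: factor_y_def y_degree_le_x_power)
qed

definition y_eval_1 :: "nat \<Rightarrow> complex fps fps \<Rightarrow> complex fps" where
  "y_eval_1 N F = (\<Sum>n\<le>N. fps_nth F n)"

text \<open>The left side sums over the triangle \<open>i + j \<le> N\<close>, the right side over a
  square. The pairs in between have \<open>i + j > N\<close>, so by the degree bound they do not
  reach x^m for \<open>m \<le> N\<close>.\<close>

lemma y_eval_1_mult:
  assumes "y_degree_le_x F" "y_degree_le_x G"
  shows "fps_agree N (y_eval_1 N (F * G)) (y_eval_1 N F * y_eval_1 N G)"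
  unfolding fps_agree_def
proof (intro allI impI)
  fix m assume m: "m \<le> N"
  let ?h = "\<lambda>(i, j). fps_nth (fps_nth F i * fps_nth G j) m"
  have "y_eval_1 N (F * G) = (\<Sum>(i, j)\<in>{(i, j). i + j \<le> N}. fps_nth F i * fps_nth G j)"
    unfolding y_eval_1_def fps_mult_nth sum.triangle_reindex_eq by (simp add: atLeast0AtMost)
  then have "fps_nth (y_eval_1 N (F * G)) m = (\<Sum>p\<in>{(i, j). i + j \<le> N}. ?h p)"
    by (simp add: fps_sum_nth case_prod_unfold)
  also have "\<dots> = (\<Sum>p\<in>{..N} \<times> {..N}. ?h p)"
  proof (rule sum.mono_neutral_left)
    show "\<forall>p\<in>{..N} \<times> {..N} - {(i, j). i + j \<le> N}. ?h p = 0"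
    proof
      fix p assume "p \<in> {..N} \<times> {..N} - {(i, j). i + j \<le> N}"
      then obtain i j where p: "p = (i, j)" "m < i + j" using m by auto
      have "fps_nth (fps_nth F i * fps_nth G j) m = 0"
        using assms p(2) by (intro mult_nth_eq_0[where i = i and j = j]) (auto simp: y_degree_le_x_def)
      then show "?h p = 0" by (simp add: p(1))
    qed
  qed auto
  also have "\<dots> = fps_nth (y_eval_1 N F * y_eval_1 N G) m"
    unfolding y_eval_1_def sum_product by (simp add: fps_sum_nth sum.cartesian_product case_prod_unfold)
  finally show "fps_nth (y_eval_1 N (F * G)) m = fps_nth (y_eval_1 N F * y_eval_1 N G) m" .
qed

lemma y_eval_1_1: "y_eval_1 N 1 = 1"
  by (simp add: y_eval_1_def sum.atMost_shift)

lemma y_eval_1_power: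
  assumes "y_degree_le_x F" "fps_agree N (y_eval_1 N F) f"
  shows "fps_agree N (y_eval_1 N (F ^ n)) (f ^ n)"
proof (induction n)
  case (Suc n)
  have "fps_agree N (y_eval_1 N F * y_eval_1 N (F ^ n)) (f * f ^ n)"
    by (intro fps_agree_mult assms Suc)
  with y_eval_1_mult[OF assms(1) y_degree_le_x_power[OF assms(1)]] show ?case
    by (auto intro: fps_agree_trans)
qed (simp add: y_eval_1_1)

lemma y_eval_1_prod:
  assumes "\<And>i. i \<in> I \<Longrightarrow> y_degree_le_x (F i)" "\<And>i. i \<in> I \<Longrightarrow> fps_agree N (y_eval_1 N (F i)) (f i)"
  shows "fps_agree N (y_eval_1 N (prod F I)) (prod f I)"
  using assms
proof (induction I rule: infinite_finite_induct)
  case (insert i I)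
  have "fps_agree N (y_eval_1 N (F i) * y_eval_1 N (prod F I)) (f i * prod f I)"
    by (intro fps_agree_mult insert) auto
  moreover have "fps_agree N (y_eval_1 N (F i * prod F I)) (y_eval_1 N (F i) * y_eval_1 N (prod F I))"
    by (intro y_eval_1_mult y_degree_le_x_prod insert.prems) auto
  ultimately show ?case using insert.hyps by (auto intro: fps_agree_trans)
qed (simp_all add: y_eval_1_1)

lemma y_eval_1_lin:
  assumes "j > 0"
  shows "fps_agree N (y_eval_1 N (lin_y j)) (1 - fps_X ^ j)"
proof (cases N)
  case 0
  \<comment> \<open>For \<open>N = 0\<close> the sum stops before the linear term, which vanishes
    modulo x anyway.\<close>
  then show ?thesis using assms by (simp add: fps_agree_def y_eval_1_def lin_y_nth)
next
  case (Suc M)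
  have "(\<Sum>n\<le>M. fps_nth (lin_y j) (Suc n)) = - (fps_X ^ j)"
    by (simp add: lin_y_nth sum.delta)
  then have "y_eval_1 N (lin_y j) = 1 - fps_X ^ j"
    unfolding y_eval_1_def Suc sum.atMost_Suc_shift by (simp add: lin_y_nth)
  then show ?thesis by simp
qed

text \<open>Evaluate \<open>lin_geom\<close> at y = 1 and cancel the unit 1 - x^j.\<close>

lemma y_eval_1_geom:
  assumes "j > 0"
  shows "fps_agree N (y_eval_1 N (geom_y j)) (inverse (1 - fps_X ^ j))"
proof -
  let ?u = "1 - fps_X ^ j :: complex fps"
  have u: "inverse ?u * ?u = 1" using assms by (intro inverse_mult_eq_1) simp
  have "y_degree_le_x (lin_y j)" "y_degree_le_x (geom_y j)"
    using y_degree_le_x_factor[OF assms, of "-1"] y_degree_le_x_factor[OF assms, of 1]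
    by (simp_all add: factor_y_def)
  then have "fps_agree N 1 (y_eval_1 N (lin_y j) * y_eval_1 N (geom_y j))"
    using y_eval_1_mult[of "lin_y j" "geom_y j" N] by (simp add: lin_geom y_eval_1_1)
  also have "fps_agree N \<dots> (?u * y_eval_1 N (geom_y j))"
    by (intro fps_agree_mult y_eval_1_lin assms) simp
  finally have "fps_agree N (inverse ?u * 1) (inverse ?u * (?u * y_eval_1 N (geom_y j)))"
    by (rule fps_agree_mult[OF fps_agree_refl])
  then show ?thesis unfolding mult.assoc[symmetric] u by (simp add: fps_agree_sym)
qed

lemma y_eval_1_factor:
  assumes "j > 0"
  shows "fps_agree N (y_eval_1 N (factor_y j e)) ((1 - fps_X ^ j) powi (- e))"
proof (cases "e \<ge> 0")
  case True
  have "y_degree_le_x (geom_y j)"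
    using y_degree_le_x_factor[OF assms, of 1] by (simp add: factor_y_def)
  \<comment> \<open>At \<open>e = 0\<close> the exponent \<open>- e\<close> falls into the
    nonnegative branch of \<open>powi\<close>, hence the separate case.\<close>
  moreover have "inverse (1 - fps_X ^ j :: complex fps) ^ nat e = (1 - fps_X ^ j) powi (- e)"
    using True by (cases "e = 0") (simp_all add: power_int_def)
  ultimately show ?thesis
    using y_eval_1_power[OF _ y_eval_1_geom[OF assms], of N "nat e"] True by (simp add: factor_y_def)
next
  case False
  have "y_degree_le_x (lin_y j)"
    using y_degree_le_x_factor[OF assms, of "-1"] by (simp add: factor_y_def)
  then show ?thesis
    using y_eval_1_power[OF _ y_eval_1_lin[OF assms], of N "nat (- e)"] False
    by (simp add: factor_y_def power_int_def)
qed

text \<open>Partial products of minus the residue; the coefficient of x^m is final from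
  \<open>N = m\<close> on.\<close>

definition residue_product :: "int \<Rightarrow> nat \<Rightarrow> complex fps" where
  "residue_product r N = (\<Prod>j=1..N. (1 - fps_X ^ j) powi (- exponent r j))"

text \<open>Multiplying by 1 - y removes the factor j = 0. In the remaining product \<open>A\<close>
  the coefficient of x^m has y-degree at most m, so it is a polynomial, and its value at 1 comes
  from putting y = 1 in \<open>A\<close>.\<close>

lemma x_coeff_Phi:
  "\<exists>P. x_coeff m (Phi r) * fps_of_poly [:1, -1:] = fps_of_poly P \<and>
       poly P 1 = fps_nth (residue_product r m) m"
proof -
  define A where "A = (\<Prod>j=1..m. factor_y j (exponent r j))"
  have A: "y_degree_le_x A"
    unfolding A_def by (intro y_degree_le_x_prod y_degree_le_x_factor) auto
  have trunc: "truncated_Phi m r = geom_y 0 * A"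
  proof -
    have "{..m} = insert 0 {1..m}" by auto
    then show ?thesis by (simp add: truncated_Phi_def A_def exponent_0 factor_y_def)
  qed
  have "fps_agree m (perm_average r n) (fps_nth (truncated_Phi m r) n)" for n
    by (rule recurrence_agree[OF perm_average_0 truncated_Phi_0 perm_average_recurrence
          truncated_Phi_recurrence one_minus_X_power_power_int_agree]) simp
  then have "x_coeff m (Phi r) = x_coeff m (truncated_Phi m r)"
    by (simp add: x_coeff_def Phi_nth fps_agree_def)
  \<comment> \<open>The factor \<open>lin_y 0\<close> is 1 - y and free of x, so it passes through
    the extraction of x^m.\<close>
  moreover have "x_coeff m G * fps_of_poly [:1, -1:] = x_coeff m (lin_y 0 * G)" for G
  proof -
    have "fps_of_poly [:1, -1 :: complex:] = 1 - fps_X"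
      by (simp add: fps_of_poly_pCons)
    show ?thesis
      unfolding \<open>fps_of_poly [:1, -1:] = 1 - fps_X\<close>
      by (intro fps_ext) (simp add: x_coeff_def lin_y_def right_diff_distrib left_diff_distrib)
  qed
  ultimately have 1: "x_coeff m (Phi r) * fps_of_poly [:1, -1:] = x_coeff m A"
    using lin_geom[of 0] by (simp add: trunc flip: mult.assoc)
  define P where "P = (\<Sum>n\<le>m. monom (fps_nth (fps_nth A n) m) n)"
  have "fps_of_poly P = x_coeff m A"
    using A by (intro fps_ext) (auto simp: P_def x_coeff_def coeff_sum y_degree_le_x_def)
  moreover have "poly P 1 = fps_nth (y_eval_1 m A) m"
    by (simp add: P_def poly_sum poly_monom y_eval_1_def fps_sum_nth)
  moreover have "fps_agree m (y_eval_1 m A) (residue_product r m)"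
    unfolding A_def residue_product_def
    by (intro y_eval_1_prod y_degree_le_x_factor y_eval_1_factor) auto
  ultimately show ?thesis using 1 by (metis fps_agree_def order_refl)
qed

section \<open>Residues of functions with denominator 1 - y\<close>

lemma residue_at_1:
  assumes "p * [:1, -1:] = P * q" "q \<noteq> 0"
  shows "residue (\<lambda>y. poly p y / poly q y) 1 = - poly P 1"
proof -
  \<comment> \<open>The hypothesis says that p/q equals P/(1-y); the sign comes from 1 - y = -(y -
    1). The finitely many roots of \<open>q\<close> other than 1 stay outside a neighbourhood of
    1.\<close>
  have "residue (\<lambda>y. poly p y / poly q y) 1 = residue (\<lambda>y. poly (- P) y / (y - 1)) 1"
  proof (rule residue_cong)
    have "finite {y. poly q y = 0}" using assms(2) by (rule poly_roots_finite)
    then have "open (- ({y. poly q y = 0} - {1}))" by (intro open_Compl finite_imp_closed) simp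
    then have "\<forall>\<^sub>F y in at 1. y \<in> - ({y. poly q y = 0} - {1}) - {1}"
      by (rule eventually_at_in_open) simp
    then show "\<forall>\<^sub>F y in at 1. poly p y / poly q y = poly (- P) y / (y - 1)"
    proof eventually_elim
      case (elim y)
      have "poly p y * (1 - y) = poly P y * poly q y"
        using arg_cong[OF assms(1), of "\<lambda>f. poly f y"] by (simp add: algebra_simps)
      with elim show ?case by (simp add: field_simps)
    qed
  qed simp
  also have "\<dots> = poly (- P) 1"
    by (rule residue_simple[of UNIV]) (auto intro!: holomorphic_intros)
  finally show ?thesis by simp
qed

text \<open>If P(1) = 0, the factor 1 - y cancels and \<open>f\<close> is a polynomial; otherwise
  P/(1-y) is already in lowest terms.\<close>

lemma is_expansion_of_exists:
  assumes "f * fps_of_poly [:1, -1:] = fps_of_poly P"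
  obtains p q where "is_expansion_of f p q" "q dvd [:1, -1:]"
proof (cases "poly P 1 = 0")
  case True
  then have "[:-1, 1:] dvd P" by (simp add: poly_eq_0_iff_dvd)
  then obtain p where "P = [:-1, 1:] * p" ..
  then have p: "P = - p * [:1, -1:]" by simp
  have "fps_of_poly [:1, -1 :: complex:] \<noteq> 0"
    by (metis fps_of_poly_0 fps_of_poly_eq_iff one_neq_zero pCons_eq_0_iff)
  then have "f = fps_of_poly (- p)"
    using assms unfolding p fps_of_poly_mult by (simp del: fps_of_poly_uminus)
  then have "is_expansion_of f (- p) 1" by (simp add: is_expansion_of_def)
  then show ?thesis by (rule that) simp
next
  case False
  have "coprime P [:1, -1:]"
  proof (rule coprimeI)
    fix d assume d: "d dvd P" "d dvd [:1, -1:]"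
    \<comment> \<open>Modulo y - 1 the polynomial \<open>P\<close> is the constant P(1), so a common
      divisor divides a nonzero constant.\<close>
    have "[:-1, 1:] dvd P - [:poly P 1:]" by (simp add: poly_eq_0_iff_dvd[symmetric])
    moreover have "d dvd [:-1, 1:]" using d(2) dvd_minus_iff[of d "[:1, -1:]"] by simp
    ultimately have "d dvd P - [:poly P 1:]" using dvd_trans by blast
    then have "d dvd [:poly P 1:]" using d(1) by (simp add: dvd_diff_right_iff)
    then show "is_unit d" using False by (meson dvd_trans is_unit_const_poly_iff is_unit_triv)
  qed
  then have "is_expansion_of f P [:1, -1:]" using assms by (simp add: is_expansion_of_def)
  then show ?thesis by (rule that) simp
qed

lemma rational_residue_simple_pole:
  assumes "f * fps_of_poly [:1, -1:] = fps_of_poly P"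
  shows "rational_at_most_simple_pole f 1" "rational_residue f 1 = - poly P 1"
proof -
  obtain p q where pq: "is_expansion_of f p q" "q dvd [:1, -1:]"
    using is_expansion_of_exists[OF assms] by auto
  have "order 1 q \<le> order 1 [:1, -1 :: complex:]"
    using pq(2) by (intro dvd_imp_order_le) auto
  also have "\<dots> \<le> degree [:1, -1 :: complex:]" by (rule order_degree) simp
  finally show "rational_at_most_simple_pole f 1"
    using pq(1) by (auto simp: rational_at_most_simple_pole_def)
  \<comment> \<open>The choice made by \<open>SOME\<close> is arbitrary, but every expansion p'/q'
    of \<open>f\<close> satisfies p'(1-y) = P q', and \<open>residue_at_1\<close> needs no
    more.\<close>
  define z where "z = (SOME (p, q). is_expansion_of f p q)"
  have "case z of (p, q) \<Rightarrow> is_expansion_of f p q"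
    unfolding z_def by (rule someI[of _ "(p, q)"]) (simp add: pq(1))
  then obtain p' q' where z: "z = (p', q')" and exp: "is_expansion_of f p' q'" by (cases z) auto
  have "fps_of_poly p' = f * fps_of_poly q'" using exp by (simp add: is_expansion_of_def)
  then have "fps_of_poly (p' * [:1, -1:]) = f * fps_of_poly [:1, -1:] * fps_of_poly q'"
    unfolding fps_of_poly_mult by (simp only: mult_ac)
  then have "p' * [:1, -1:] = P * q'"
    unfolding assms by (simp only: fps_of_poly_mult[symmetric] fps_of_poly_eq_iff)
  moreover have "q' \<noteq> 0" using exp by (simp add: is_expansion_of_def)
  ultimately show "rational_residue f 1 = - poly P 1"
    unfolding rational_residue_def z_def[symmetric] z by (simp add: residue_at_1)
qed

section \<open>Convergence of the infinite product\<close>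

lemma one_minus_X_power_power_int_agree_1:
  assumes "N < j"
  shows "fps_agree N ((1 - fps_X ^ j :: complex fps) powi e) 1"
proof -
  let ?u = "1 - fps_X ^ j :: complex fps"
  have u: "fps_agree N ?u 1" using assms by (simp add: fps_agree_def)
  have "inverse ?u * ?u = 1" using assms by (intro inverse_mult_eq_1) simp
  then have "fps_agree N 1 (inverse ?u * 1)"
    using fps_agree_mult[OF fps_agree_refl u, of "inverse ?u"] by simp
  then have "fps_agree N (inverse ?u) 1" by (simp add: fps_agree_sym)
  then show ?thesis
    using fps_agree_power[OF u, of "nat e"] fps_agree_power[of N "inverse ?u" 1 "nat (- e)"]
    by (simp add: power_int_def)
qed

lemma residue_product_agree:
  assumes "m \<le> N"
  shows "fps_agree m (residue_product r N) (residue_product r m)"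
proof -
  have "fps_agree m (residue_product r N)
      (\<Prod>j=1..N. if j \<le> m then (1 - fps_X ^ j) powi (- exponent r j) else 1)"
    unfolding residue_product_def
    by (intro fps_agree_prod) (auto intro: one_minus_X_power_power_int_agree_1)
  also have "(\<Prod>j=1..N. if j \<le> m then (1 - fps_X ^ j) powi (- exponent r j) else 1) = residue_product r m"
    unfolding residue_product_def using assms by (intro prod.mono_neutral_cong_right) auto
  finally show ?thesis .
qed

lemma residue_product_has_prod:
  "raw_has_prod (\<lambda>k. (1 - fps_X ^ Suc k :: complex fps) powi (- exponent r (Suc k))) 0
     (Abs_fps (\<lambda>m. fps_nth (residue_product r m) m))"
  unfolding raw_has_prod_def
proof
  show "(\<lambda>n. \<Prod>i\<le>n. (1 - fps_X ^ Suc (i + 0)) powi (- exponent r (Suc (i + 0))))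
      \<longlonglongrightarrow> Abs_fps (\<lambda>m. fps_nth (residue_product r m) m)"
  proof (rule tendsto_fpsI)
    fix m
    show "\<forall>\<^sub>F n in sequentially. fps_nth (\<Prod>i\<le>n. (1 - fps_X ^ Suc (i + 0)) powi (- exponent r (Suc (i + 0)))) m
        = fps_nth (Abs_fps (\<lambda>m. fps_nth (residue_product r m) m)) m"
      using eventually_ge_at_top[of m]
    proof eventually_elim
      case (elim n)
      have "(\<Prod>i\<le>n. (1 - fps_X ^ Suc (i + 0)) powi (- exponent r (Suc (i + 0)))) = residue_product r (Suc n)"
        unfolding residue_product_def
        by (rule prod.reindex_bij_witness[of _ "\<lambda>j. j - 1" Suc]) auto
      then show ?case
        using residue_product_agree[of m "Suc n" r] elim by (simp add: fps_agree_def)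
    qed
  qed
  \<comment> \<open>\<open>raw_has_prod\<close> demands a nonzero limit; the constant term here is
    an empty product, that is 1.\<close>
  have "fps_nth (Abs_fps (\<lambda>m. fps_nth (residue_product r m) m)) 0 \<noteq> 0"
    by (simp add: residue_product_def)
  then show "Abs_fps (\<lambda>m. fps_nth (residue_product r m) m) \<noteq> 0"
    by (metis fps_zero_nth)
qed

section \<open>Colored partitions\<close>

text \<open>Used on two levels: parts are multisets of colors of weight 1, and colored partitions
  are multisets of parts weighted by their size.\<close>

definition weighted_multisets :: "'a set \<Rightarrow> ('a \<Rightarrow> nat) \<Rightarrow> nat \<Rightarrow> 'a multiset set" where
  "weighted_multisets Q s n = {P. set_mset P \<subseteq> Q \<and> (\<Sum>x\<in>#P. s x) = n}"

lemma weighted_multisets_empty: "weighted_multisets {} s n = (if n = 0 then {{#}} else {})"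
  by (auto simp: weighted_multisets_def)

text \<open>Either \<open>q\<close> does not occur or one copy of it is removed; further copies may
  remain.\<close>

lemma weighted_multisets_insert:
  assumes "q \<notin> Q"
  shows "weighted_multisets (insert q Q) s n = weighted_multisets Q s n \<union>
    (if s q \<le> n then add_mset q ` weighted_multisets (insert q Q) s (n - s q) else {})"
    (is "?L = ?R")
proof (intro equalityI subsetI)
  fix P assume P: "P \<in> ?L"
  show "P \<in> ?R"
  proof (cases "q \<in># P")
    case True
    then obtain P' where P': "P = add_mset q P'" by (meson multi_member_split)
    with P have "P' \<in> weighted_multisets (insert q Q) s (n - s q)" "s q \<le> n"
      by (auto simp: weighted_multisets_def)
    then show ?thesis by (simp add: P')
  next
    case False
    with P show ?thesis by (auto simp: weighted_multisets_def)
  qed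
next
  fix P assume "P \<in> ?R"
  then show "P \<in> ?L" by (auto simp: weighted_multisets_def split: if_splits)
qed

lemma finite_weighted_multisets:
  assumes "finite Q" "\<And>q. q \<in> Q \<Longrightarrow> s q > 0"
  shows "finite (weighted_multisets Q s n)"
  using assms
proof (induction Q arbitrary: n rule: finite_induct)
  case empty
  then show ?case by (simp add: weighted_multisets_empty)
next
  case (insert q Q)
  show ?case
  \<comment> \<open>The same alphabet returns with the smaller total \<open>n - s q\<close>, so an
    inner induction on \<open>n\<close> is needed.\<close>
  proof (induction n rule: less_induct)
    case (less n)
    have "finite (weighted_multisets (insert q Q) s (n - s q))" if "s q \<le> n"
      using that insert.prems[of q] by (intro less) auto
    then show ?case
      using insert by (subst weighted_multisets_insert) auto
  qed
qed

text \<open>By the splitting at \<open>q\<close>, multiplying the series for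
  \<open>insert q Q\<close> by the unit 1 - x^(s q) yields the series for \<open>Q\<close>.\<close>

lemma weighted_multisets_fps:
  assumes "finite Q" "\<And>q. q \<in> Q \<Longrightarrow> s q > 0"
  shows "Abs_fps (\<lambda>n. of_nat (card (weighted_multisets Q s n))) =
    (\<Prod>q\<in>Q. inverse (1 - fps_X ^ s q) :: 'a :: field_char_0 fps)"
  using assms
proof (induction Q rule: finite_induct)
  case empty
  show ?case by (rule fps_ext) (simp add: weighted_multisets_empty)
next
  case (insert q Q)
  let ?F = "\<lambda>Q. Abs_fps (\<lambda>n. of_nat (card (weighted_multisets Q s n))) :: 'a fps"
  have card: "card (weighted_multisets (insert q Q) s n) = card (weighted_multisets Q s n) +
      (if s q \<le> n then card (weighted_multisets (insert q Q) s (n - s q)) else 0)" for n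
  proof -
    have "weighted_multisets Q s n \<inter> add_mset q ` weighted_multisets (insert q Q) s (n - s q) = {}"
    proof -
      have "q \<notin># P" if "P \<in> weighted_multisets Q s n" for P
        using that insert.hyps(2) unfolding weighted_multisets_def by blast
      then show ?thesis by fastforce
    qed
    moreover have "finite (weighted_multisets Q s n)"
      "finite (weighted_multisets (insert q Q) s (n - s q))"
      using insert by (auto intro!: finite_weighted_multisets)
    moreover have "inj_on (add_mset q) A" for A by (simp add: inj_on_def)
    ultimately show ?thesis
      by (subst weighted_multisets_insert[OF insert.hyps(2)]) (simp add: card_Un_disjoint card_image)
  qed
  have mult: "(1 - fps_X ^ s q) * ?F (insert q Q) = ?F Q"
    by (rule fps_ext) (simp add: left_diff_distrib fps_X_power_mult_nth card)
  have inv: "inverse (1 - fps_X ^ s q) * (1 - fps_X ^ s q) = (1 :: 'a fps)"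
    using insert.prems[of q] by (intro inverse_mult_eq_1) simp
  have "?F (insert q Q) = inverse (1 - fps_X ^ s q) * (1 - fps_X ^ s q) * ?F (insert q Q)"
    by (simp only: inv mult_1_left)
  also have "\<dots> = inverse (1 - fps_X ^ s q) * ?F Q" by (simp only: mult.assoc mult)
  also have "?F Q = (\<Prod>q\<in>Q. inverse (1 - fps_X ^ s q))"
    by (rule insert.IH) (use insert.prems in auto)
  finally show ?case using insert.hyps by simp
qed

text \<open>Both sides are coefficients of (1-x)^(-c): c letters of weight 1 give c factors
  1/(1-x).\<close>

lemma card_weighted_multisets_size:
  "int (card (weighted_multisets {..<c} (\<lambda>_. Suc 0) k)) = exponent (- int c) k"
proof -
  have "Abs_fps (\<lambda>n. of_nat (card (weighted_multisets {..<c} (\<lambda>_. Suc 0) n))) =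
      (1 - fps_X :: complex fps) powi (- int c)"
    by (subst weighted_multisets_fps) (auto simp: power_int_def)
  also have "\<dots> = Abs_fps (\<lambda>j. of_int (exponent (- int c) j))" by (rule one_minus_X_power_int)
  finally have "(of_nat (card (weighted_multisets {..<c} (\<lambda>_. Suc 0) k)) :: complex) = of_int (exponent (- int c) k)"
    by (simp add: fps_eq_iff)
  then have "(of_int (int (card (weighted_multisets {..<c} (\<lambda>_. Suc 0) k))) :: complex) = of_int (exponent (- int c) k)"
    by simp
  then show ?thesis by (simp only: of_int_eq_iff)
qed

lemma card_colored_partitions:
  "of_nat (card (colored_partitions c n)) = fps_nth (residue_product (- int c) n) n"
proof -
  let ?W = "weighted_multisets {..<c} (\<lambda>_. Suc 0)"
  have W: "M \<in> ?W k \<longleftrightarrow> set_mset M \<subseteq> {..<c} \<and> size M = k" for M k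
    by (simp add: weighted_multisets_def flip: size_eq_sum_mset)
  define Q where "Q = (\<Union>k\<in>{1..n}. ?W k)"
  have fin: "finite (?W k)" for k by (intro finite_weighted_multisets) auto
  have Q: "M \<in> Q \<longleftrightarrow> M \<noteq> {#} \<and> set_mset M \<subseteq> {..<c} \<and> size M \<le> n" for M
    unfolding Q_def by (auto simp: W Suc_le_eq nonempty_has_size)
  \<comment> \<open>No part exceeds the total \<open>n\<close>, so the finite set \<open>Q\<close>
    contains every part that can occur.\<close>
  have "size M \<le> (\<Sum>M\<in>#P. size M)" if "M \<in># P" for M and P :: "nat multiset multiset"
    using multi_member_split[OF that] by auto
  then have colored: "colored_partitions c n = weighted_multisets Q size n"
    unfolding colored_partitions_def weighted_multisets_def by (auto simp: Q subset_iff)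
  \<comment> \<open>\<open>Q\<close> depends on the outer \<open>n\<close> while the bound
    \<open>n\<close> runs over all totals; only the coefficient at the outer \<open>n\<close> is
    used below.\<close>
  have "Abs_fps (\<lambda>n. of_nat (card (weighted_multisets Q size n))) =
      (\<Prod>M\<in>Q. inverse (1 - fps_X ^ size M) :: complex fps)"
    by (rule weighted_multisets_fps) (auto simp: Q_def fin W)
  also have "\<dots> =
      (\<Prod>k\<in>{1..n}. \<Prod>M\<in>?W k. inverse (1 - fps_X ^ size M))"
    unfolding Q_def using fin by (intro prod.UNION_disjoint) (auto simp: W)
  also have "\<dots> =
      residue_product (- int c) n"
    unfolding residue_product_def
  proof (intro prod.cong refl)
    fix k
    have "(\<Prod>M\<in>?W k. inverse (1 - fps_X ^ size M) :: complex fps) = (\<Prod>M\<in>?W k. inverse (1 - fps_X ^ k))"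
      by (intro prod.cong refl) (simp add: W)
    also have "\<dots> = inverse (1 - fps_X ^ k) ^ card (?W k)" by simp
    \<comment> \<open>The exponent in the product formula is the number of possible parts of size
      \<open>k\<close>.\<close>
    also have "\<dots> = (1 - fps_X ^ k) powi (- exponent (- int c) k)"
      unfolding card_weighted_multisets_size[symmetric] by (simp add: power_int_def)
    finally show "(\<Prod>M\<in>?W k. inverse (1 - fps_X ^ size M) :: complex fps) =
        (1 - fps_X ^ k) powi (- exponent (- int c) k)" .
  qed
  finally have "fps_nth (Abs_fps (\<lambda>n. of_nat (card (weighted_multisets Q size n)))) n =
      fps_nth (residue_product (- int c) n) n" by simp
  then show ?thesis by (simp add: colored)
qed

theorem corollary1p3:
  fixes r :: int
  shows "(\<forall>m. rational_at_most_simple_pole (x_coeff m (Phi r)) 1) \<and>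
         convergent_prod (\<lambda>k::nat.
           (1 - fps_X ^ Suc k :: complex fps) powi (- int_binomial (int (Suc k) - r - 1) (Suc k))) \<and>
         Res_y 1 (Phi r) = - (\<Prod>k::nat.
           (1 - fps_X ^ Suc k :: complex fps) powi (- int_binomial (int (Suc k) - r - 1) (Suc k))) \<and>
         (\<forall>c::nat. c > 0 \<and> int c = - r \<longrightarrow>
            - Res_y 1 (Phi r) = Abs_fps (\<lambda>n. of_nat (card (colored_partitions c n))))"
proof -
  define f where "f = (\<lambda>k. (1 - fps_X ^ Suc k :: complex fps) powi (- int_binomial (int (Suc k) - r - 1) (Suc k)))"
  define G where "G = Abs_fps (\<lambda>m. fps_nth (residue_product r m) m)"
  have raw: "raw_has_prod f 0 G"
    using residue_product_has_prod[of r] by (simp only: f_def G_def exponent_def)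
  then have prod: "prodinf f = G" by (metis has_prod_def has_prod_unique)
  have pole: "rational_at_most_simple_pole (x_coeff m (Phi r)) 1"
    and residue: "rational_residue (x_coeff m (Phi r)) 1 = - fps_nth G m" for m
    using x_coeff_Phi[of m r] rational_residue_simple_pole by (auto simp: G_def)
  have Res: "Res_y 1 (Phi r) = - G"
    by (rule fps_ext) (simp add: Res_y_def residue)
  have "- Res_y 1 (Phi r) = Abs_fps (\<lambda>n. of_nat (card (colored_partitions c n)))" if "int c = - r" for c
  proof -
    have "- int c = r" using that by simp
    then show ?thesis by (simp add: Res G_def card_colored_partitions)
  qed
  with pole raw Res show ?thesis
    unfolding f_def[symmetric] prod by (auto simp: convergent_prod_def)
qed

end
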